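(* Let $\mathbb{F}$ be an arbitrary field, let $P(\lambda)=\sum_{k=0}^dP_k\lambda^k\in\mathbb{F}[\lambda]^{n\times n}$ have even degree $d\geq 2$ and nonsingular leading coefficient $P_d$, let $Q(\lambda)=\sum_{k=0}^{d-1}P_k\lambda^k$, let $t=d/2$, let $\sigma\in\{1,-1\}$, and let $$\mathcal{L}(\lambda)=\begin{bmatrix}\lambda B+A&\widehat{L}_t(\lambda)^T\otimes I_n\\ \sigma\widehat{L}_t(\lambda)\otimes I_n&0\end{bmatrix},\qquad \lambda B+A=\begin{bmatrix} M_{11}(\lambda) & M_{12}(\lambda) \\ M_{21}(\lambda) & M_{22}(\lambda) \end{bmatrix},$$ where $\lambda B+A$ is a pencil over $\mathbb{F}$ with blocks $M_{11}(\lambda)$ of size $n\times n$, $M_{12}(\lambda)$ of size $n\times tn$, $M_{21}(\lambda)$ of size $tn\times n$, and $M_{22}(\lambda)$ of size $tn\times tn$. Then either of the following conditions guarantees that $\mathcal{L}(\lambda)$ is a strong linearization of $P(\lambda)$: (a) $P_d=-M_{11}(\lambda)$, $\ \lambda^tP_d=M_{12}(\lambda)(\Lambda_{t-1}(\lambda)\otimes I_n)=(\Lambda_{t-1}(\lambda)^T\otimes I_n)M_{21}(\lambda)$, and $Q(\lambda)=(\Lambda_{t-1}(\lambda)^T\otimes I_n)M_{22}(\lambda)(\Lambda_{t-1}(\lambda)\otimes I_n)$; (b) $P_d=-M_{11}(\lambda)$, $\ \lambda^tP_d=\mathrm{su}\big(M_{12}(\lambda)\odot(\Lambda_{t-1}(\lambda)^T\otimes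 I_n)\big)=\mathrm{su}\big(M_{21}(\lambda)\odot(\Lambda_{t-1}(\lambda)\otimes I_n)\big)$, and $Q(\lambda)=\mathrm{su}\big(M_{22}(\lambda)\odot\Gamma_{t-1}(\lambda)\big)$.
   Context: $\widehat{L}_k(\lambda)\in\mathbb{F}[\lambda]^{(k-1)\times(k+1)}$ is the matrix whose first column is zero and whose $(i,i+1)$ entries are $-1$ and $(i,i+2)$ entries are $\lambda$ ($i=1,\dots,k-1$), all other entries being zero (for $k=1$ it is an empty $0\times 2$ matrix). $\Lambda_k(\lambda)^T=\begin{bmatrix}\lambda^k&\cdots&\lambda&1\end{bmatrix}$, a $1\times(k+1)$ row. $\Gamma_k(\lambda)=(\Lambda_k(\lambda)\otimes I_n)(\Lambda_k(\lambda)^T\otimes I_n)$. For a (not necessarily square) block matrix with $n\times n$ blocks $X_{ij}$, $\mathrm{su}(X)=\sum_{i,j}X_{ij}$; for two conformably partitioned block matrices with $n\times n$ blocks, $X\odot Y$ is the block matrix with $(i,j)$ block $X_{ij}Y_{ij}$. A pencil $L(\lambda)=\lambda X+Y$ is a linearization of $P(\lambda)$ if there exist unimodular matrix polynomials $U(\lambda),V(\lambda)$ with $U(\lambda)L(\lambda)V(\lambda)=\mathrm{diag}(I_m,P(\lambda))$ for some natural number $m$; it is a strong linearization of $P(\lambda)$ (of degree $d$) if in addition $\mathrm{rev}_1L(\lambda)=\lambda Y+X$ is a linearization of $\mathrm{rev}_dP(\lambda)=\lambda^dP(\lambda^{-1})$. *)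

theory Defs
  imports "Jordan_Normal_Form.Determinant"
begin

text \<open>A matrix polynomial over a field is a matrix whose entries are univariate polynomials;
  the indeterminate \<open>\<lambda>\<close> is \<^term>\<open>monom 1 1\<close>. Rows and columns are indexed from 0.\<close>

definition const_mat :: "'a::field mat \<Rightarrow> 'a poly mat" where
  "const_mat A = map_mat (\<lambda>c. [:c:]) A"

definition matpoly :: "nat \<Rightarrow> (nat \<Rightarrow> 'a::field mat) \<Rightarrow> nat \<Rightarrow> 'a poly mat" where
  "matpoly n C d = mat n n (\<lambda>(i,j). \<Sum>k\<le>d. monom (C k $$ (i,j)) k)"

definition mat_degree :: "'a::field poly mat \<Rightarrow> nat" where
  "mat_degree P = Max (degree ` elements_mat P)"

definition pencil_mat :: "'a::field mat \<Rightarrow> 'a mat \<Rightarrow> 'a poly mat" where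
  "pencil_mat X Y = monom 1 1 \<cdot>\<^sub>m const_mat X + const_mat Y"

definition is_pencil :: "'a::field poly mat \<Rightarrow> bool" where
  "is_pencil L \<longleftrightarrow> (\<exists>X Y. X \<in> carrier_mat (dim_row L) (dim_col L)
     \<and> Y \<in> carrier_mat (dim_row L) (dim_col L) \<and> L = pencil_mat X Y)"

text \<open>Reversal with respect to the grade \<open>d\<close>. Unlike \<^const>\<open>reflect_poly\<close>, the grade may exceed
  the degree of the individual entry; coefficients beyond \<open>d\<close> are not looked at.\<close>

definition rev_poly :: "nat \<Rightarrow> 'a::field poly \<Rightarrow> 'a poly" where
  "rev_poly d p = (\<Sum>i\<le>d. monom (coeff p i) (d - i))"

definition rev_mat :: "nat \<Rightarrow> 'a::field poly mat \<Rightarrow> 'a poly mat" where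
  "rev_mat d P = map_mat (rev_poly d) P"

lemma poly_rev_poly:
  fixes x :: "'a::field"
  assumes "degree p \<le> d" "x \<noteq> 0"
  shows "poly (rev_poly d p) x = x ^ d * poly p (inverse x)"
proof -
  have "poly p (inverse x) = (\<Sum>i\<le>d. coeff p i * inverse x ^ i)"
    unfolding poly_altdef using assms(1)
    by (intro sum.mono_neutral_left) (auto simp: coeff_eq_0)
  moreover have "(\<Sum>i\<le>d. x ^ d * (coeff p i * inverse x ^ i)) = (\<Sum>i\<le>d. coeff p i * x ^ (d - i))"
    using assms(2) by (intro sum.cong) (auto simp: power_diff field_simps)
  ultimately show ?thesis
    unfolding rev_poly_def
    by (simp del: mult_eq_0_iff mult_cancel_left add: poly_sum poly_monom sum_distrib_left)
qed

lemma rev_mat_pencil_mat: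
  fixes X Y :: "'a::field mat"
  assumes "X \<in> carrier_mat r c" "Y \<in> carrier_mat r c"
  shows "rev_mat 1 (pencil_mat X Y) = pencil_mat Y X"
  using assms
  by (intro eq_matI)
     (auto simp: rev_mat_def rev_poly_def pencil_mat_def const_mat_def monom_altdef
        atMost_Suc coeff_pCons)

definition unimodular :: "'a::field poly mat \<Rightarrow> bool" where
  "unimodular U \<longleftrightarrow> square_mat U \<and> (\<exists>c. c \<noteq> 0 \<and> det U = [:c:])"

definition linearization :: "'a::field poly mat \<Rightarrow> 'a poly mat \<Rightarrow> bool" where
  "linearization L P \<longleftrightarrow> is_pencil L \<and>
     (\<exists>m U V. L \<in> carrier_mat (m + dim_row P) (m + dim_col P)
        \<and> U \<in> carrier_mat (m + dim_row P) (m + dim_row P) \<and> unimodular U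
        \<and> V \<in> carrier_mat (m + dim_col P) (m + dim_col P) \<and> unimodular V
        \<and> U * L * V = four_block_mat (1\<^sub>m m) (0\<^sub>m m (dim_col P)) (0\<^sub>m (dim_row P) m) P)"

definition strong_linearization :: "'a::field poly mat \<Rightarrow> 'a poly mat \<Rightarrow> bool" where
  "strong_linearization L P \<longleftrightarrow>
     linearization L P \<and> linearization (rev_mat 1 L) (rev_mat (mat_degree P) P)"

definition kron :: "'a::semiring_1 mat \<Rightarrow> 'a mat \<Rightarrow> 'a mat" (infixl "\<otimes>\<^sub>k" 75) where
  "A \<otimes>\<^sub>k B = mat (dim_row A * dim_row B) (dim_col A * dim_col B)
     (\<lambda>(i,j). A $$ (i div dim_row B, j div dim_col B) * B $$ (i mod dim_row B, j mod dim_col B))"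

definition block :: "nat \<Rightarrow> 'a mat \<Rightarrow> nat \<Rightarrow> nat \<Rightarrow> 'a mat" where
  "block n X i j = mat n n (\<lambda>(r,s). X $$ (i * n + r, j * n + s))"

definition su :: "nat \<Rightarrow> 'a::semiring_1 mat \<Rightarrow> 'a mat" where
  "su n X = mat n n (\<lambda>(r,s).
     \<Sum>i<dim_row X div n. \<Sum>j<dim_col X div n. block n X i j $$ (r,s))"

text \<open>The \<open>(i,j)\<close> block of the result is the matrix product of the \<open>(i,j)\<close> blocks.\<close>

definition block_odot :: "nat \<Rightarrow> 'a::semiring_1 mat \<Rightarrow> 'a mat \<Rightarrow> 'a mat" where
  "block_odot n X Y = mat (dim_row X) (dim_col X) (\<lambda>(r,s).
     (block n X (r div n) (s div n) * block n Y (r div n) (s div n)) $$ (r mod n, s mod n))"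

definition Lhat :: "nat \<Rightarrow> 'a::field poly mat" where
  "Lhat k = mat (k - 1) (k + 1)
     (\<lambda>(i,j). if j = i + 1 then - 1 else if j = i + 2 then monom 1 1 else 0)"

definition Lambda_col :: "nat \<Rightarrow> 'a::field poly mat" where
  "Lambda_col k = mat (k + 1) 1 (\<lambda>(i,j). monom 1 (k - i))"

definition Gamma_mat :: "nat \<Rightarrow> nat \<Rightarrow> 'a::field poly mat" where
  "Gamma_mat n k = (Lambda_col k \<otimes>\<^sub>k 1\<^sub>m n) * (transpose_mat (Lambda_col k) \<otimes>\<^sub>k 1\<^sub>m n)"

end

theory Submission
  imports Defs
begin

text \<open>\<open>Lhat\<close> annihilates the columns of \<open>diag(1, \<Lambda>)\<close>, and these extend to a unimodular matrix \<open>W\<close>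
  with \<open>Lhat W = [0 | I]\<close>. Congruence with \<open>diag(W \<otimes> I, I)\<close> followed by a Schur complement therefore
  reduces the bordered pencil to \<open>diag(I, N)\<close>, where \<open>N\<close> is the compression of \<open>\<lambda>B + A\<close> to
  \<open>diag(I, \<Lambda> \<otimes> I)\<close>, that is \<open>N = [-P_d, \<lambda>^t P_d; \<lambda>^t P_d, Q]\<close>. As \<open>P_d\<close> is invertible, its Schur
  complement gives \<open>Q + \<lambda>^(2t) P_d = P\<close>.

  Reversal is multiplicative once degree bounds are added up, so the reversed pencil has the same
  shape with \<open>rev \<Lambda> = (1, \<lambda>, ..., \<lambda>^(t-1))\<close> and \<open>N = [-\<lambda> P_d, P_d; P_d, rev Q]\<close>. The Schur
  complement of the off-diagonal \<open>P_d\<close> is now \<open>P_d + \<lambda> rev Q = rev P\<close>.\<close>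

subsection \<open>Unimodular equivalence\<close>

text \<open>The units of a polynomial ring over a field are the nonzero constants, so a determinant
  that divides 1 is one of them.\<close>

lemma unimodularI_det_dvd:
  assumes "U \<in> carrier_mat n n" "det U dvd 1"
  shows "unimodular U"
  using assms unfolding unimodular_def is_unit_poly_iff
  by (auto simp: is_unit_iff_degree dvd_field_iff)

lemma unimodularI:
  assumes "U \<in> carrier_mat n n" "U' \<in> carrier_mat n n" "U * U' = 1\<^sub>m n"
  shows "unimodular U"
proof (rule unimodularI_det_dvd[OF assms(1)])
  have "det U * det U' = 1"
    using assms by (metis det_mult det_one)
  then show "det U dvd 1"
    by (metis dvd_triv_left)
qed

text \<open>Multiplicativity of \<open>det\<close> makes an inverse on either side enough. The
  left-sided form serves the completed border matrix, for which a left inverse is what the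
  construction yields.\<close>

lemma unimodularI':
  assumes "U \<in> carrier_mat n n" "U' \<in> carrier_mat n n" "U' * U = 1\<^sub>m n"
  shows "unimodular U"
proof (rule unimodularI_det_dvd[OF assms(1)])
  have "det U' * det U = 1"
    using assms by (metis det_mult det_one)
  then show "det U dvd 1"
    by (metis dvd_triv_right)
qed

lemma unimodular_mult:
  assumes "U \<in> carrier_mat n n" "V \<in> carrier_mat n n" "unimodular U" "unimodular V"
  shows "unimodular (U * V)"
  using assms unfolding unimodular_def by (auto simp: det_mult)

lemma unimodular_transpose:
  assumes "U \<in> carrier_mat n n" "unimodular U"
  shows "unimodular (transpose_mat U)"
  using assms unfolding unimodular_def by (auto simp: det_transpose)

text \<open>The sizes of both factors are read off from \<open>M\<close>. Being transitive, the
  relation lets the reduction be written as a calculation with the unimodular factors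
  hidden.\<close>

definition uequiv :: "'a::field poly mat \<Rightarrow> 'a poly mat \<Rightarrow> bool" where
  "uequiv M N \<longleftrightarrow> (\<exists>U V. U \<in> carrier_mat (dim_row M) (dim_row M) \<and> unimodular U
     \<and> V \<in> carrier_mat (dim_col M) (dim_col M) \<and> unimodular V \<and> U * M * V = N)"

lemma uequivI_unimodular:
  assumes "M \<in> carrier_mat r c" "U \<in> carrier_mat r r" "unimodular U"
    and "V \<in> carrier_mat c c" "unimodular V" "U * M * V = N"
  shows "uequiv M N"
proof -
  have dims: "dim_row M = r" "dim_col M = c"
    using assms(1) by auto
  show ?thesis
    unfolding uequiv_def dims using assms(2-6) by blast
qed

lemma uequivI:
  assumes "M \<in> carrier_mat r c"
    and "U \<in> carrier_mat r r" "U' \<in> carrier_mat r r" "U * U' = 1\<^sub>m r"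
    and "V \<in> carrier_mat c c" "V' \<in> carrier_mat c c" "V * V' = 1\<^sub>m c"
    and "U * M * V = N"
  shows "uequiv M N"
  using assms by (intro uequivI_unimodular[of M r c U V] unimodularI[of U r U'] unimodularI[of V c V'])

lemma uequiv_trans [trans]:
  assumes "uequiv M N" "uequiv N K"
  shows "uequiv M K"
proof -
  obtain U V where UV: "U \<in> carrier_mat (dim_row M) (dim_row M)" "unimodular U"
    "V \<in> carrier_mat (dim_col M) (dim_col M)" "unimodular V" "U * M * V = N"
    using assms(1) unfolding uequiv_def by auto
  obtain U' V' where UV': "U' \<in> carrier_mat (dim_row N) (dim_row N)" "unimodular U'"
    "V' \<in> carrier_mat (dim_col N) (dim_col N)" "unimodular V'" "U' * N * V' = K"
    using assms(2) unfolding uequiv_def by auto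
  define r c where r_c_def: "r = dim_row M" "c = dim_col M"
  have M: "M \<in> carrier_mat r c"
    by (auto simp: r_c_def)
  have N: "N \<in> carrier_mat r c"
    using UV by (auto simp: r_c_def)
  have car: "U \<in> carrier_mat r r" "V \<in> carrier_mat c c" "U' \<in> carrier_mat r r" "V' \<in> carrier_mat c c"
    using UV UV' N by (auto simp: r_c_def)
  have "(U' * U) * M * (V * V') = U' * ((U * M) * V) * V'"
    using car M by (simp add: assoc_mult_mat[of _ r r _ r _ c] assoc_mult_mat[of _ r r _ c _ c]
        assoc_mult_mat[of _ r c _ c _ c] assoc_mult_mat[of _ c c _ c _ c])
  also have "\<dots> = K"
    using UV UV' by simp
  finally show ?thesis
    unfolding uequiv_def r_c_def[symmetric]
    using car UV UV' unimodular_mult[of U' r U] unimodular_mult[of V c V']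
    by (intro exI[of _ "U' * U"] exI[of _ "V * V'"]) auto
qed

lemma linearizationI:
  assumes "is_pencil L" "P \<in> carrier_mat r c" "L \<in> carrier_mat (m + r) (m + c)"
    and "uequiv L (four_block_mat (1\<^sub>m m) (0\<^sub>m m c) (0\<^sub>m r m) P)"
  shows "linearization L P"
  using assms unfolding linearization_def uequiv_def by auto

text \<open>Block Gaussian elimination with pivot \<open>Z\<close>. The inverse \<open>Z'\<close>
  has to be a polynomial matrix as well, hence it is passed as data.\<close>

lemma uequiv_schur:
  fixes Z Z' b c d :: "'a::field poly mat"
  assumes Z: "Z \<in> carrier_mat p p" "Z' \<in> carrier_mat p p" "Z * Z' = 1\<^sub>m p" "Z' * Z = 1\<^sub>m p"
    and b: "b \<in> carrier_mat p q" and c: "c \<in> carrier_mat r p" and d: "d \<in> carrier_mat r q"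
  shows "uequiv (four_block_mat Z b c d)
           (four_block_mat (1\<^sub>m p) (0\<^sub>m p q) (0\<^sub>m r p) (d - c * Z' * b))"
proof -
  \<comment> \<open>\<open>?U\<close> divides the first block row by \<open>Z\<close> and subtracts
    \<open>c\<close> times the result from the second; \<open>?V\<close> then clears the block
    \<open>Z' * b\<close> left beside the identity. \<open>?U'\<close> and \<open>?V'\<close> are
    their inverses.\<close>
  let ?U = "four_block_mat Z' (0\<^sub>m p r) (- (c * Z')) (1\<^sub>m r)"
  let ?U' = "four_block_mat Z (0\<^sub>m p r) c (1\<^sub>m r)"
  let ?V = "four_block_mat (1\<^sub>m p) (- (Z' * b)) (0\<^sub>m q p) (1\<^sub>m q)"
  let ?V' = "four_block_mat (1\<^sub>m p) (Z' * b) (0\<^sub>m q p) (1\<^sub>m q)"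
  have cZZ: "c * Z' * Z = c"
    using Z c by (simp add: assoc_mult_mat[of _ r p _ p _ p])
  have cZ: "c * Z' \<in> carrier_mat r p" "Z' * b \<in> carrier_mat p q" "c * Z' * b \<in> carrier_mat r q"
    using Z b c by auto
  have neg: "- (c * Z') * Z = - c" "- (c * Z') * b = - (c * Z' * b)"
    using uminus_mult_left_mat[of "c * Z'" Z] uminus_mult_left_mat[of "c * Z'" b] cZ Z b cZZ
    by auto
  have UU: "?U * ?U' = 1\<^sub>m (p + r)"
    unfolding four_block_one_mat[symmetric]
    by (subst mult_four_block_mat[of _ p p _ r _ r _ _ p _ r])
      (use Z c cZ neg in \<open>auto simp: uminus_l_inv_mat intro!: cong_four_block_mat
        simp del: four_block_one_mat\<close>)
  have "Z' * b + - (Z' * b) = 0\<^sub>m p q"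
    using cZ minus_add_uminus_mat[of "Z' * b" p q "Z' * b"] by auto
  then have VV: "?V * ?V' = 1\<^sub>m (p + q)"
    unfolding four_block_one_mat[symmetric]
    by (subst mult_four_block_mat[of _ p p _ q _ q _ _ p _ q])
      (use Z b cZ in \<open>auto intro!: cong_four_block_mat
        simp del: four_block_one_mat\<close>)
  have UM: "?U * four_block_mat Z b c d
      = four_block_mat (1\<^sub>m p) (Z' * b) (0\<^sub>m r p) (d - c * Z' * b)"
    by (subst mult_four_block_mat[of _ p p _ r _ r _ _ p _ q])
      (use Z b c d cZ neg in \<open>auto simp: uminus_l_inv_mat
        intro!: cong_four_block_mat\<close>)
  have "?U * four_block_mat Z b c d * ?V
      = four_block_mat (1\<^sub>m p) (0\<^sub>m p q) (0\<^sub>m r p) (d - c * Z' * b)"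
    unfolding UM
    by (subst mult_four_block_mat[of _ p p _ q _ r _ _ p _ q])
      (use Z b c d cZ in \<open>auto simp: uminus_l_inv_mat
        intro!: cong_four_block_mat\<close>)
  then show ?thesis
    by (intro uequivI[OF _ _ _ UU _ _ VV]) (use Z b c d cZ in auto)
qed

section \<open>Exchanging block rows and block columns\<close>

definition swap_mat :: "nat \<Rightarrow> nat \<Rightarrow> 'a::field poly mat" where
  "swap_mat p q = four_block_mat (0\<^sub>m p q) (1\<^sub>m p) (1\<^sub>m q) (0\<^sub>m q p)"

lemma swap_mat_carrier [simp]:
  "swap_mat p q \<in> carrier_mat (p + q) (p + q)"
  unfolding swap_mat_def by (auto simp: add.commute intro!: carrier_matI)

lemma swap_mat_inverse: "swap_mat p q * swap_mat q p = 1\<^sub>m (p + q)"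
proof -
  have "swap_mat p q * swap_mat q p
      = four_block_mat (1\<^sub>m p) (0\<^sub>m p q) (0\<^sub>m q p) (1\<^sub>m q)"
    unfolding swap_mat_def by (subst mult_four_block_mat[of _ p q _ p _ q _ _ p _ q]) auto
  then show ?thesis
    by simp
qed

lemma four_block_mult_swap:
  assumes "a \<in> carrier_mat r p" "b \<in> carrier_mat r q" "c \<in> carrier_mat s p" "d \<in> carrier_mat s q"
  shows "four_block_mat a b c d * swap_mat p q = four_block_mat b a d c"
  unfolding swap_mat_def using assms
  by (subst mult_four_block_mat[of _ r p _ q _ s _ _ q _ p]) auto

lemma swap_mult_four_block:
  assumes "a \<in> carrier_mat r p" "b \<in> carrier_mat r q" "c \<in> carrier_mat s p" "d \<in> carrier_mat s q"
  shows "swap_mat s r * four_block_mat a b c d = four_block_mat c d a b"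
  unfolding swap_mat_def using assms
  by (subst mult_four_block_mat[of _ s r _ s _ r _ _ p _ q]) auto

lemma uequiv_swap_cols:
  assumes "a \<in> carrier_mat r p" "b \<in> carrier_mat r q" "c \<in> carrier_mat s p" "d \<in> carrier_mat s q"
  shows "uequiv (four_block_mat a b c d) (four_block_mat b a d c)"
proof (rule uequivI[OF _ _ _ _ _ _ swap_mat_inverse[of p q]])
  show car: "four_block_mat a b c d \<in> carrier_mat (r + s) (p + q)"
    using assms by simp
  show "1\<^sub>m (r + s) * four_block_mat a b c d * swap_mat p q = four_block_mat b a d c"
    unfolding left_mult_one_mat[OF car] by (rule four_block_mult_swap[OF assms])
  show "swap_mat q p \<in> carrier_mat (p + q) (p + q)"
    using swap_mat_carrier[of q p] by (simp only: add.commute)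
  show "1\<^sub>m (r + s) * 1\<^sub>m (r + s) = (1\<^sub>m (r + s) :: 'a poly mat)"
    by simp
qed auto

lemma uequiv_swap:
  assumes "a \<in> carrier_mat r p" "b \<in> carrier_mat r q" "c \<in> carrier_mat s p" "d \<in> carrier_mat s q"
  shows "uequiv (four_block_mat a b c d) (four_block_mat d c b a)"
proof -
  have "uequiv (four_block_mat a b c d) (four_block_mat c d a b)"
  proof (rule uequivI[OF _ _ _ swap_mat_inverse[of s r]])
    show car: "four_block_mat a b c d \<in> carrier_mat (s + r) (p + q)"
      using four_block_carrier_mat[OF assms(1,4), of b c] by (simp only: add.commute)
    show "swap_mat s r * four_block_mat a b c d * 1\<^sub>m (p + q) = four_block_mat c d a b"
      unfolding swap_mult_four_block[OF assms] using assms
      by (intro right_mult_one_mat[of _ "s + r"]) simp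
    show "swap_mat r s \<in> carrier_mat (s + r) (s + r)"
      using swap_mat_carrier[of r s] by (simp only: add.commute)
    show "1\<^sub>m (p + q) * 1\<^sub>m (p + q) = (1\<^sub>m (p + q) :: 'a poly mat)"
      by simp
  qed auto
  also have "uequiv (four_block_mat c d a b) (four_block_mat d c b a)"
    using assms by (intro uequiv_swap_cols)
  finally show ?thesis .
qed

section \<open>Eliminating the border\<close>

text \<open>The same matrix is cut after row and column \<open>r\<close> instead of
  \<open>r + q\<close>. \<open>E\<close> is the normalized border \<open>[0 | I]\<close>, written
  with empty lower blocks. The new lower right block \<open>[D, I; s I, 0]\<close> is the pivot for
  the elimination.\<close>

lemma four_block_regroup:
  fixes A B C D :: "'a::semiring_1 mat"
  assumes "A \<in> carrier_mat r r" "B \<in> carrier_mat r q" "C \<in> carrier_mat q r" "D \<in> carrier_mat q q"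
  defines "E \<equiv> four_block_mat (0\<^sub>m q r) (1\<^sub>m q) (0\<^sub>m 0 r) (0\<^sub>m 0 q)"
  shows "four_block_mat (four_block_mat A B C D) (transpose_mat E) (s \<cdot>\<^sub>m E) (0\<^sub>m q q)
    = four_block_mat A (four_block_mat B (0\<^sub>m r q) (0\<^sub>m 0 q) (0\<^sub>m 0 q))
        (four_block_mat C (0\<^sub>m q 0) (0\<^sub>m q r) (0\<^sub>m q 0))
        (four_block_mat D (1\<^sub>m q) (s \<cdot>\<^sub>m 1\<^sub>m q) (0\<^sub>m q q))" (is "?l = ?r")
proof -
  have dims: "dim_row A = r" "dim_col A = r" "dim_row B = r" "dim_col B = q" "dim_row C = q"
    "dim_col C = r" "dim_row D = q" "dim_col D = q"
    using assms by auto
  show ?thesis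
  proof (rule eq_matI)
    fix i j
    assume "i < dim_row ?r" "j < dim_col ?r"
    then have ij: "i < r + (q + q)" "j < r + (q + q)"
      by (simp_all add: dims)
    consider "i < r" | "\<not> i < r" "i - r < q" | "\<not> i < r" "\<not> i - r < q" "i - r - q < q"
      using ij by linarith
    then show "?l $$ (i, j) = ?r $$ (i, j)"
      using ij unfolding E_def by cases (auto simp: dims)
  qed (auto simp: dims E_def)
qed

text \<open>The hypotheses say that \<open>R\<close> stacked on \<open>H\<close> is a left inverse
  of \<open>[W1 | W2]\<close>, which turns \<open>H\<close> into \<open>[0 | I]\<close>. After the
  congruence the border meets only the last \<open>q\<close> coordinates of \<open>X\<close>; these
  and the border are eliminated together, leaving the compression of \<open>X\<close> to the columns
  annihilated by \<open>H\<close>.\<close>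

lemma uequiv_bordered:
  fixes X H W1 W2 R :: "'a::field poly mat" and s :: "'a poly"
  assumes X: "X \<in> carrier_mat (r + q) (r + q)" and H: "H \<in> carrier_mat q (r + q)"
    and W1: "W1 \<in> carrier_mat (r + q) r" and W2: "W2 \<in> carrier_mat (r + q) q"
    and R: "R \<in> carrier_mat r (r + q)"
    and RW: "R * W1 = 1\<^sub>m r" "R * W2 = 0\<^sub>m r q"
    and HW: "H * W1 = 0\<^sub>m q r" "H * W2 = 1\<^sub>m q"
    and s: "s * s = 1"
  shows "uequiv (four_block_mat X (transpose_mat H) (s \<cdot>\<^sub>m H) (0\<^sub>m q q))
     (four_block_mat (1\<^sub>m (q + q)) (0\<^sub>m (q + q) r) (0\<^sub>m r (q + q)) (transpose_mat W1 * X * W1))"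
proof -
  \<comment> \<open>Blocks with no rows make \<open>four_block_mat\<close> a horizontal
    concatenation: \<open>W\<close> is \<open>[W1 | W2]\<close>. Likewise \<open>G\<close>, with
    blocks of no columns, is \<open>R\<close> stacked on \<open>H\<close>.\<close>
  define W where "W = four_block_mat W1 W2 (0\<^sub>m 0 r) (0\<^sub>m 0 q)"
  let ?t = transpose_mat
  have W: "W \<in> carrier_mat (r + q) (r + q)"
    using four_block_carrier_mat[OF W1, of "0\<^sub>m 0 q" 0 q] unfolding W_def by simp
  define G where "G = four_block_mat R (0\<^sub>m r 0) H (0\<^sub>m q 0)"
  have G: "G \<in> carrier_mat (r + q) (r + q)"
    using four_block_carrier_mat[OF R, of "0\<^sub>m q 0" q 0] unfolding G_def by simp
  have GW: "G * W = 1\<^sub>m (r + q)"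
  proof -
    have "G * W = four_block_mat (1\<^sub>m r) (0\<^sub>m r q) (0\<^sub>m q r) (1\<^sub>m q)"
      unfolding G_def W_def using R H W1 W2
      by (subst mult_four_block_mat[of _ r "r + q" _ 0 _ q _ _ r _ q])
        (auto simp: RW HW simp del: four_block_one_mat intro!: cong_four_block_mat eq_matI)
    then show ?thesis
      by simp
  qed
  have mult_W: "Y * W = four_block_mat (Y * W1) (Y * W2) (0\<^sub>m 0 r) (0\<^sub>m 0 q)"
    if Y: "Y \<in> carrier_mat k (r + q)" for Y k
  proof -
    \<comment> \<open>Padding with empty blocks gives \<open>Y\<close> the 2 by 2 shape that the
      block product rule expects.\<close>
    have "Y = four_block_mat Y (0\<^sub>m k 0) (0\<^sub>m 0 (r + q)) (0\<^sub>m 0 0)"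
      using Y by (intro eq_matI) auto
    then have "Y * W = four_block_mat Y (0\<^sub>m k 0) (0\<^sub>m 0 (r + q)) (0\<^sub>m 0 0) * W"
      by simp
    also have "\<dots> = four_block_mat (Y * W1) (Y * W2) (0\<^sub>m 0 r) (0\<^sub>m 0 q)"
      unfolding W_def using Y W1 W2
      by (subst mult_four_block_mat[of _ k "r + q" _ 0 _ 0 _ _ r _ q])
        (auto intro!: cong_four_block_mat eq_matI)
    finally show ?thesis .
  qed
  define T11 T12 T21 T22 where T_def: "T11 = ?t W1 * X * W1" "T12 = ?t W1 * X * W2"
    "T21 = ?t W2 * X * W1" "T22 = ?t W2 * X * W2"
  have T: "T11 \<in> carrier_mat r r" "T12 \<in> carrier_mat r q" "T21 \<in> carrier_mat q r" "T22 \<in> carrier_mat q q"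
    using X W1 W2 unfolding T_def by auto
  have HW': "H * W = four_block_mat (0\<^sub>m q r) (1\<^sub>m q) (0\<^sub>m 0 r) (0\<^sub>m 0 q)"
    using mult_W[OF H] HW by simp
  have tW: "?t W = four_block_mat (?t W1) (0\<^sub>m r 0) (?t W2) (0\<^sub>m q 0)"
    unfolding W_def using W1 W2 by (subst transpose_four_block_mat[of _ "r + q" r _ q _ 0]) auto
  have WXW: "?t W * X * W = four_block_mat T11 T12 T21 T22"
  proof -
    have "?t W * X * W = ?t W * (X * W)"
      using W X by (intro assoc_mult_mat) auto
    also have "\<dots> = four_block_mat (?t W1 * (X * W1)) (?t W1 * (X * W2))
        (?t W2 * (X * W1)) (?t W2 * (X * W2))"
      unfolding mult_W[OF X] tW using X W1 W2
      by (subst mult_four_block_mat[of _ r "r + q" _ 0 _ q _ _ r _ q])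
        (auto intro!: cong_four_block_mat eq_matI)
    also have "\<dots> = four_block_mat T11 T12 T21 T22"
      unfolding T_def using X W1 W2
      by (simp add: assoc_mult_mat[of _ _ "r + q" _ "r + q"])
    finally show ?thesis .
  qed
  let ?L = "four_block_mat X (?t H) (s \<cdot>\<^sub>m H) (0\<^sub>m q q)"
  let ?V = "four_block_mat W (0\<^sub>m (r + q) q) (0\<^sub>m q (r + q)) (1\<^sub>m q)"
  let ?V' = "four_block_mat G (0\<^sub>m (r + q) q) (0\<^sub>m q (r + q)) (1\<^sub>m q)"
  have car: "?V \<in> carrier_mat (r + q + q) (r + q + q)" "?V' \<in> carrier_mat (r + q + q) (r + q + q)"
    using W G by auto
  have VV: "?V' * ?V = 1\<^sub>m (r + q + q)"
    unfolding four_block_one_mat[symmetric, of "r + q" q] using W G GW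
    by (subst mult_four_block_mat[of _ "r + q" "r + q" _ q _ q _ _ "r + q" _ q])
      (auto intro!: cong_four_block_mat simp del: four_block_one_mat)
  have unimod: "unimodular ?V"
    by (rule unimodularI'[OF car VV])
  then have tunimod: "unimodular (?t ?V)"
    by (rule unimodular_transpose[OF car(1)])
  have tV: "?t ?V = four_block_mat (?t W) (0\<^sub>m (r + q) q) (0\<^sub>m q (r + q)) (1\<^sub>m q)"
    using W by (subst transpose_four_block_mat[of _ "r + q" "r + q" _ q _ q]) auto
  have sHW: "s \<cdot>\<^sub>m H * W = s \<cdot>\<^sub>m (H * W)"
    using mult_smult_assoc_mat[OF H W] by simp
  have "?t ?V * ?L * ?V
      = four_block_mat (?t W * X) (?t W * ?t H) (s \<cdot>\<^sub>m H) (0\<^sub>m q q) * ?V"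
    unfolding tV using W X H
    by (subst mult_four_block_mat[of _ "r + q" "r + q" _ q _ q _ _ "r + q" _ q])
      (auto simp: left_mult_one_mat[of _ q "r + q"])
  also have "\<dots> = four_block_mat (?t W * X * W) (?t (H * W)) (s \<cdot>\<^sub>m (H * W)) (0\<^sub>m q q)"
    using W X H
    by (subst mult_four_block_mat[of _ "r + q" "r + q" _ q _ q _ _ "r + q" _ q])
      (auto simp: sHW transpose_mult[OF H W] right_mult_one_mat[of _ "r + q" q]
        intro!: cong_four_block_mat)
  finally have reduced: "uequiv ?L (four_block_mat (?t W * X * W) (?t (H * W)) (s \<cdot>\<^sub>m (H * W)) (0\<^sub>m q q))"
    by (intro uequivI_unimodular[OF _ _ tunimod car(1) unimod]) (use X W in auto)
  \<comment> \<open>The inverse of \<open>[T22, I; s I, 0]\<close>, using that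
    \<open>s * s = 1\<close> makes \<open>s\<close> its own inverse.\<close>
  let ?Z' = "four_block_mat (0\<^sub>m q q) (s \<cdot>\<^sub>m 1\<^sub>m q) (1\<^sub>m q) ((- s) \<cdot>\<^sub>m T22)"
  have ss: "s * (s * x) = x" for x
    using s by (metis mult.assoc mult_1)
  have TT: "T22 * (s \<cdot>\<^sub>m 1\<^sub>m q) + (- s) \<cdot>\<^sub>m T22 = 0\<^sub>m q q"
    "T22 + (- s) \<cdot>\<^sub>m T22 * (s \<cdot>\<^sub>m 1\<^sub>m q) = 0\<^sub>m q q"
    "s \<cdot>\<^sub>m 1\<^sub>m q * (s \<cdot>\<^sub>m 1\<^sub>m q) = 1\<^sub>m q" "s \<cdot>\<^sub>m (1\<^sub>m q * (s \<cdot>\<^sub>m 1\<^sub>m q)) = 1\<^sub>m q"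
    using T by (auto simp: mult_smult_distrib[of _ q q _ q] s ss intro!: eq_matI)
  note reduced
  also have "four_block_mat (?t W * X * W) (?t (H * W)) (s \<cdot>\<^sub>m (H * W)) (0\<^sub>m q q)
     = four_block_mat T11 (four_block_mat T12 (0\<^sub>m r q) (0\<^sub>m 0 q) (0\<^sub>m 0 q))
        (four_block_mat T21 (0\<^sub>m q 0) (0\<^sub>m q r) (0\<^sub>m q 0))
        (four_block_mat T22 (1\<^sub>m q) (s \<cdot>\<^sub>m 1\<^sub>m q) (0\<^sub>m q q))"
    unfolding WXW HW' by (rule four_block_regroup[OF T])
  also have "uequiv \<dots> (four_block_mat (four_block_mat T22 (1\<^sub>m q) (s \<cdot>\<^sub>m 1\<^sub>m q) (0\<^sub>m q q))
        (four_block_mat T21 (0\<^sub>m q 0) (0\<^sub>m q r) (0\<^sub>m q 0))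
        (four_block_mat T12 (0\<^sub>m r q) (0\<^sub>m 0 q) (0\<^sub>m 0 q)) T11)"
    (is "uequiv _ (four_block_mat ?Z ?b ?c _)")
    using T by (intro uequiv_swap[of _ r r _ "q + q" _ "q + q"]) auto
  also have "uequiv \<dots> (four_block_mat (1\<^sub>m (q + q)) (0\<^sub>m (q + q) r) (0\<^sub>m r (q + q))
      (T11 - ?c * ?Z' * ?b))"
  proof (rule uequiv_schur)
    show "?Z * ?Z' = 1\<^sub>m (q + q)"
      unfolding four_block_one_mat[symmetric] using T s TT
      by (subst mult_four_block_mat[of _ q q _ q _ q _ _ q _ q])
        (auto simp del: four_block_one_mat intro!: cong_four_block_mat)
    show "?Z' * ?Z = 1\<^sub>m (q + q)"
      unfolding four_block_one_mat[symmetric] using T s TT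
      by (subst mult_four_block_mat[of _ q q _ q _ q _ _ q _ q])
        (auto simp del: four_block_one_mat intro!: cong_four_block_mat)
  qed (use T in auto)
  \<comment> \<open>\<open>?c\<close> is \<open>[T12, 0]\<close> and \<open>?b\<close> is
    \<open>T21\<close> over \<open>0\<close>, so only the upper left block of \<open>?Z'\<close>
    enters, and it is zero. Hence \<open>T12\<close>, \<open>T21\<close> and \<open>T22\<close>
    leave no trace.\<close>
  also have "?c * ?Z' * ?b = 0\<^sub>m r r"
  proof -
    have "?c * ?Z' = four_block_mat (0\<^sub>m r q) (s \<cdot>\<^sub>m T12) (0\<^sub>m 0 q) (0\<^sub>m 0 q)"
      using T by (subst mult_four_block_mat[of _ r q _ q _ 0 _ _ q _ q])
        (auto intro!: cong_four_block_mat eq_matI)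
    also have "\<dots> * ?b = four_block_mat (0\<^sub>m r r) (0\<^sub>m r 0) (0\<^sub>m 0 r) (0\<^sub>m 0 0)"
      using T by (subst mult_four_block_mat[of _ r q _ q _ 0 _ _ r _ 0])
        (auto intro!: cong_four_block_mat eq_matI)
    finally show ?thesis
      by simp
  qed
  also have "T11 - 0\<^sub>m r r = T11"
    using T by (intro eq_matI) auto
  finally show ?thesis
    unfolding T_def .
qed

subsection \<open>Block matrices and Kronecker products with the identity\<close>

lemma kron_carrier [simp]:
  assumes "A \<in> carrier_mat a b" "B \<in> carrier_mat m n"
  shows "A \<otimes>\<^sub>k B \<in> carrier_mat (a * m) (b * n)"
  using assms by (auto simp: kron_def)

lemma block_index_less:
  fixes i r a n :: nat
  assumes "i < a" "r < n"
  shows "i * n + r < a * n"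
proof -
  have "i * n + r < Suc i * n"
    using assms(2) by simp
  also have "\<dots> \<le> a * n"
    using assms(1) by (intro mult_le_mono1) simp
  finally show ?thesis .
qed

lemma block_index_cases:
  fixes p a n :: nat
  assumes "p < a * n"
  obtains i r where "p = i * n + r" "i < a" "r < n"
proof
  show "p = p div n * n + p mod n" by simp
  have "n > 0" using assms by (cases n) auto
  then show "p mod n < n" by simp
  show "p div n < a" using assms by (simp add: less_mult_imp_div_less)
qed

lemma index_kron_one:
  assumes "A \<in> carrier_mat a b" "i < a" "j < b" "r < n" "s < n"
  shows "(A \<otimes>\<^sub>k 1\<^sub>m n) $$ (i * n + r, j * n + s) = (if r = s then A $$ (i, j) else 0)"
  using assms block_index_less[of i a r n] block_index_less[of j b s n]
  by (auto simp: kron_def)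

text \<open>Division with remainder writes every index as \<open>i * n + r\<close> with
  \<open>r < n\<close>. In these coordinates Kronecker products with \<open>1\<^sub>m n\<close> have
  entries free of \<open>div\<close> and \<open>mod\<close>.\<close>

lemma eq_mat_blockI:
  assumes "X \<in> carrier_mat (a * n) (b * n)" "Y \<in> carrier_mat (a * n) (b * n)"
    and "\<And>i j r s. i < a \<Longrightarrow> j < b \<Longrightarrow> r < n \<Longrightarrow> s < n \<Longrightarrow>
      X $$ (i * n + r, j * n + s) = Y $$ (i * n + r, j * n + s)"
  shows "X = Y"
proof (rule eq_matI)
  fix p q
  assume "p < dim_row Y" "q < dim_col Y"
  then have "p < a * n" "q < b * n"
    using assms(2) by auto
  then show "X $$ (p, q) = Y $$ (p, q)"
    using assms(3) by (elim block_index_cases) auto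
qed (use assms in auto)

lemma sum_blocks:
  fixes f :: "nat \<Rightarrow> 'a::comm_monoid_add"
  shows "(\<Sum>k<b * n. f k) = (\<Sum>j<b. \<Sum>s<n. f (j * n + s))"
proof -
  have "sum f {j * n..<j * n + n} = (\<Sum>s<n. f (j * n + s))" for j
    using sum.shift_bounds_nat_ivl[of f 0 "j * n" n]
    by (simp add: atLeast0LessThan add.commute)
  then show ?thesis
    using sum.nat_group[of f n b] by simp
qed

text \<open>Column \<open>j * n + s\<close> of the Kronecker factor is supported on rows with the
  same offset \<open>s\<close>, so the sum over \<open>b * n\<close> indices collapses to one term
  per block.\<close>

lemma index_mult_kron_one:
  fixes X :: "'a::semiring_1 mat"
  assumes "X \<in> carrier_mat m (b * n)" "A \<in> carrier_mat b c" "p < m" "j < c" "s < n"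
  shows "(X * (A \<otimes>\<^sub>k 1\<^sub>m n)) $$ (p, j * n + s) = (\<Sum>k<b. X $$ (p, k * n + s) * A $$ (k, j))"
proof -
  have "dim_row (A \<otimes>\<^sub>k 1\<^sub>m n) = b * n" "dim_col (A \<otimes>\<^sub>k 1\<^sub>m n) = c * n"
    using assms by (auto simp: kron_def)
  then have "(X * (A \<otimes>\<^sub>k 1\<^sub>m n)) $$ (p, j * n + s)
      = (\<Sum>k<b * n. X $$ (p, k) * (A \<otimes>\<^sub>k 1\<^sub>m n) $$ (k, j * n + s))"
    using assms block_index_less[of j c s n]
    by (auto simp: scalar_prod_def atLeast0LessThan intro!: sum.cong)
  also have "\<dots> = (\<Sum>k<b. \<Sum>u<n. if u = s then X $$ (p, k * n + s) * A $$ (k, j) else 0)"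
    unfolding sum_blocks using assms
    by (intro sum.cong refl) (auto simp: index_kron_one[OF assms(2)])
  also have "\<dots> = (\<Sum>k<b. X $$ (p, k * n + s) * A $$ (k, j))"
    using assms by simp
  finally show ?thesis .
qed

lemma index_kron_one_mult:
  fixes X :: "'a::semiring_1 mat"
  assumes "X \<in> carrier_mat (b * n) m" "A \<in> carrier_mat a b" "i < a" "r < n" "q < m"
  shows "((A \<otimes>\<^sub>k 1\<^sub>m n) * X) $$ (i * n + r, q) = (\<Sum>k<b. A $$ (i, k) * X $$ (k * n + r, q))"
proof -
  have "dim_row (A \<otimes>\<^sub>k 1\<^sub>m n) = a * n" "dim_col (A \<otimes>\<^sub>k 1\<^sub>m n) = b * n"
    using assms by (auto simp: kron_def)
  then have "((A \<otimes>\<^sub>k 1\<^sub>m n) * X) $$ (i * n + r, q)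
      = (\<Sum>k<b * n. (A \<otimes>\<^sub>k 1\<^sub>m n) $$ (i * n + r, k) * X $$ (k, q))"
    using assms block_index_less[of i a r n]
    by (auto simp: scalar_prod_def atLeast0LessThan intro!: sum.cong)
  also have "\<dots> = (\<Sum>k<b. \<Sum>u<n. if u = r then A $$ (i, k) * X $$ (k * n + r, q) else 0)"
    unfolding sum_blocks using assms
    by (intro sum.cong refl) (auto simp: index_kron_one[OF assms(2)])
  also have "\<dots> = (\<Sum>k<b. A $$ (i, k) * X $$ (k * n + r, q))"
    using assms by simp
  finally show ?thesis .
qed

text \<open>The mixed product rule for second factor \<open>1\<^sub>m n\<close>. It carries the
  scalar identities between \<open>H\<close>, \<open>R\<close>, \<open>W1\<close> and
  \<open>W2\<close> over to blocks of size \<open>n\<close>.\<close>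

lemma kron_one_mult:
  fixes A B :: "'a::semiring_1 mat"
  assumes "A \<in> carrier_mat a b" "B \<in> carrier_mat b c"
  shows "(A \<otimes>\<^sub>k 1\<^sub>m n) * (B \<otimes>\<^sub>k 1\<^sub>m n) = (A * B) \<otimes>\<^sub>k 1\<^sub>m n"
proof (rule eq_mat_blockI[of _ a n c])
  have car: "A \<otimes>\<^sub>k 1\<^sub>m n \<in> carrier_mat (a * n) (b * n)" "B \<otimes>\<^sub>k 1\<^sub>m n \<in> carrier_mat (b * n) (c * n)"
    "A * B \<in> carrier_mat a c"
    using assms by auto
  then show "(A \<otimes>\<^sub>k 1\<^sub>m n) * (B \<otimes>\<^sub>k 1\<^sub>m n) \<in> carrier_mat (a * n) (c * n)"
    "(A * B) \<otimes>\<^sub>k 1\<^sub>m n \<in> carrier_mat (a * n) (c * n)"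
    by auto
  fix i j r s
  assume *: "i < a" "j < c" "r < n" "s < n"
  have "((A \<otimes>\<^sub>k 1\<^sub>m n) * (B \<otimes>\<^sub>k 1\<^sub>m n)) $$ (i * n + r, j * n + s)
      = (\<Sum>k<b. A $$ (i, k) * (B \<otimes>\<^sub>k 1\<^sub>m n) $$ (k * n + r, j * n + s))"
    using * block_index_less[of j c s n] by (intro index_kron_one_mult[OF car(2) assms(1)])
  also have "\<dots> = (if r = s then (A * B) $$ (i, j) else 0)"
    using * assms by (auto simp: index_kron_one[OF assms(2)] scalar_prod_def atLeast0LessThan
        intro!: sum.cong)
  finally show "((A \<otimes>\<^sub>k 1\<^sub>m n) * (B \<otimes>\<^sub>k 1\<^sub>m n)) $$ (i * n + r, j * n + s)
      = ((A * B) \<otimes>\<^sub>k 1\<^sub>m n) $$ (i * n + r, j * n + s)"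
    using * by (simp add: index_kron_one[OF car(3)])
qed

lemma kron_one_one: "1\<^sub>m a \<otimes>\<^sub>k 1\<^sub>m n = (1\<^sub>m (a * n) :: 'a::semiring_1 mat)"
proof (rule eq_mat_blockI[of _ a n a])
  fix i j r s
  assume *: "i < a" "j < a" "r < n" "s < n"
  have "i * n + r = j * n + s \<longleftrightarrow> i = j \<and> r = s"
    using * by (metis div_mult_self3 div_less add.right_neutral mod_mult_self3 mod_less not_less0)
  then show "(1\<^sub>m a \<otimes>\<^sub>k 1\<^sub>m n) $$ (i * n + r, j * n + s)
      = (1\<^sub>m (a * n) :: 'a mat) $$ (i * n + r, j * n + s)"
    using * block_index_less[of i a r n] block_index_less[of j a s n]
    by (auto simp: index_kron_one[of _ a a])
qed auto

lemma transpose_kron_one: "transpose_mat (A \<otimes>\<^sub>k 1\<^sub>m n) = transpose_mat A \<otimes>\<^sub>k 1\<^sub>m n"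
proof (cases "n = 0")
  case False
  then show ?thesis
    by (intro eq_matI) (auto simp: kron_def less_mult_imp_div_less)
qed (auto simp: kron_def)

lemma zero_kron_one: "0\<^sub>m a b \<otimes>\<^sub>k 1\<^sub>m n = 0\<^sub>m (a * n) (b * n)"
  by (rule eq_matI) (auto simp: kron_def less_mult_imp_div_less)

lemma map_kron_one:
  assumes "f 0 = 0"
  shows "map_mat f (A \<otimes>\<^sub>k 1\<^sub>m n) = map_mat f A \<otimes>\<^sub>k 1\<^sub>m n"
proof (rule eq_mat_blockI[of _ "dim_row A" n "dim_col A"])
  fix i j r s
  assume *: "i < dim_row A" "j < dim_col A" "r < n" "s < n"
  show "map_mat f (A \<otimes>\<^sub>k 1\<^sub>m n) $$ (i * n + r, j * n + s)
      = (map_mat f A \<otimes>\<^sub>k 1\<^sub>m n) $$ (i * n + r, j * n + s)"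
    using * block_index_less[of i "dim_row A" r n] block_index_less[of j "dim_col A" s n] assms
    by (subst index_map_mat)
      (auto simp: index_kron_one[of _ "dim_row A" "dim_col A"] kron_def[of _ "1\<^sub>m n"])
qed (auto simp: kron_def)

lemma kron_one_four_block:
  assumes "A \<in> carrier_mat a b" "B \<in> carrier_mat a b'" "C \<in> carrier_mat a' b" "D \<in> carrier_mat a' b'"
  shows "four_block_mat A B C D \<otimes>\<^sub>k 1\<^sub>m n
    = four_block_mat (A \<otimes>\<^sub>k 1\<^sub>m n) (B \<otimes>\<^sub>k 1\<^sub>m n) (C \<otimes>\<^sub>k 1\<^sub>m n) (D \<otimes>\<^sub>k 1\<^sub>m n)"
    (is "?l = ?r")
proof (rule eq_mat_blockI[of _ "a + a'" n "b + b'"])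
  have F: "four_block_mat A B C D \<in> carrier_mat (a + a') (b + b')"
    using assms by simp
  have K: "A \<otimes>\<^sub>k 1\<^sub>m n \<in> carrier_mat (a * n) (b * n)" "D \<otimes>\<^sub>k 1\<^sub>m n \<in> carrier_mat (a' * n) (b' * n)"
    using assms by auto
  show "?l \<in> carrier_mat ((a + a') * n) ((b + b') * n)"
    by (rule kron_carrier[OF F]) simp
  show "?r \<in> carrier_mat ((a + a') * n) ((b + b') * n)"
    unfolding distrib_right by (rule four_block_carrier_mat[OF K])
  fix i j r s
  assume *: "i < a + a'" "j < b + b'" "r < n" "s < n"
  \<comment> \<open>The cuts lie at multiples of \<open>n\<close>, so no block is split and the
    block index alone selects the quadrant.\<close>
  have shift: "(k * n + u < m * n) = (k < m)" "\<not> k < m \<Longrightarrow> k * n + u - m * n = (k - m) * n + u"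
    if "u < n" for k u m
  proof -
    show "(k * n + u < m * n) = (k < m)"
    proof (cases "k < m")
      case True
      then show ?thesis
        using block_index_less[OF _ that] by simp
    next
      case False
      then have "m * n \<le> k * n"
        by simp
      then show ?thesis
        using False by linarith
    qed
    show "k * n + u - m * n = (k - m) * n + u" if "\<not> k < m"
      using that mult_le_mono1[of m k n] by (simp add: diff_mult_distrib)
  qed
  have dims: "dim_row (A \<otimes>\<^sub>k 1\<^sub>m n) = a * n" "dim_col (A \<otimes>\<^sub>k 1\<^sub>m n) = b * n"
    "dim_row (D \<otimes>\<^sub>k 1\<^sub>m n) = a' * n" "dim_col (D \<otimes>\<^sub>k 1\<^sub>m n) = b' * n"
    using K by auto
  have "?r $$ (i * n + r, j * n + s) = (if i < a
      then if j < b then (A \<otimes>\<^sub>k 1\<^sub>m n) $$ (i * n + r, j * n + s)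
        else (B \<otimes>\<^sub>k 1\<^sub>m n) $$ (i * n + r, (j - b) * n + s)
      else if j < b then (C \<otimes>\<^sub>k 1\<^sub>m n) $$ ((i - a) * n + r, j * n + s)
        else (D \<otimes>\<^sub>k 1\<^sub>m n) $$ ((i - a) * n + r, (j - b) * n + s))"
    using * block_index_less[of i "a + a'" r n] block_index_less[of j "b + b'" s n]
    by (subst index_mat_four_block) (simp_all add: dims shift distrib_right)
  moreover have "?l $$ (i * n + r, j * n + s) = (if r = s then four_block_mat A B C D $$ (i, j) else 0)"
    using * by (intro index_kron_one[OF F])
  ultimately show "?l $$ (i * n + r, j * n + s) = ?r $$ (i * n + r, j * n + s)"
    using * assms(1,4)
    by (auto simp: index_kron_one[OF assms(1)] index_kron_one[OF assms(2)]
        index_kron_one[OF assms(3)] index_kron_one[OF assms(4)])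
qed

section \<open>Block sums with Kronecker weights\<close>

text \<open>The \<open>(i, j)\<close> block of the weight is a scalar matrix with value
  \<open>S $$ (i, j)\<close>, so each block product is a scaling.\<close>

lemma su_block_odot_kron_one:
  fixes X S :: "'a::semiring_1 mat"
  assumes "X \<in> carrier_mat (a * n) (b * n)" "S \<in> carrier_mat a b"
  shows "su n (block_odot n X (S \<otimes>\<^sub>k 1\<^sub>m n))
    = mat n n (\<lambda>(r, s). \<Sum>i<a. \<Sum>j<b. X $$ (i * n + r, j * n + s) * S $$ (i, j))"
proof (rule eq_matI)
  fix r s
  assume "r < dim_row (mat n n (\<lambda>(r, s). \<Sum>i<a. \<Sum>j<b. X $$ (i * n + r, j * n + s) * S $$ (i, j)))"
    "s < dim_col (mat n n (\<lambda>(r, s). \<Sum>i<a. \<Sum>j<b. X $$ (i * n + r, j * n + s) * S $$ (i, j)))"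
  then have rs: "r < n" "s < n"
    by auto
  have "block n (block_odot n X (S \<otimes>\<^sub>k 1\<^sub>m n)) i j $$ (r, s)
      = X $$ (i * n + r, j * n + s) * S $$ (i, j)" if ij: "i < a" "j < b" for i j
  proof -
    have "block n (block_odot n X (S \<otimes>\<^sub>k 1\<^sub>m n)) i j $$ (r, s)
        = (block n X i j * block n (S \<otimes>\<^sub>k 1\<^sub>m n) i j) $$ (r, s)"
      using rs ij assms block_index_less[of i a r n] block_index_less[of j b s n]
      by (auto simp: block_odot_def block_def)
    also have "\<dots> = (\<Sum>u<n. X $$ (i * n + r, j * n + u) * (S \<otimes>\<^sub>k 1\<^sub>m n) $$ (i * n + u, j * n + s))"
      using rs by (auto simp: block_def scalar_prod_def atLeast0LessThan intro!: sum.cong)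
    also have "\<dots> = (\<Sum>u<n. if u = s then X $$ (i * n + r, j * n + s) * S $$ (i, j) else 0)"
      using rs ij by (intro sum.cong refl) (auto simp: index_kron_one[OF assms(2)])
    also have "\<dots> = X $$ (i * n + r, j * n + s) * S $$ (i, j)"
      using rs by simp
    finally show ?thesis .
  qed
  moreover have "n > 0"
    using rs by simp
  ultimately show "su n (block_odot n X (S \<otimes>\<^sub>k 1\<^sub>m n)) $$ (r, s)
    = mat n n (\<lambda>(r, s). \<Sum>i<a. \<Sum>j<b. X $$ (i * n + r, j * n + s) * S $$ (i, j)) $$ (r, s)"
    using rs assms by (simp add: su_def block_odot_def)
qed (auto simp: su_def)

text \<open>Multiplying a block by a scalar multiple of the identity on the left or on the right is the
  same, which is why the two conditions of the theorem coincide.\<close>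

lemma su_block_odot_outer_product:
  fixes X :: "'a::comm_semiring_1 mat"
  assumes X: "X \<in> carrier_mat (a * n) (b * n)"
    and u: "u \<in> carrier_mat 1 a" and v: "v \<in> carrier_mat b 1"
    and S: "S \<in> carrier_mat a b" "\<And>i j. i < a \<Longrightarrow> j < b \<Longrightarrow> S $$ (i, j) = u $$ (0, i) * v $$ (j, 0)"
  shows "su n (block_odot n X (S \<otimes>\<^sub>k 1\<^sub>m n)) = (u \<otimes>\<^sub>k 1\<^sub>m n) * X * (v \<otimes>\<^sub>k 1\<^sub>m n)"
proof (rule eq_matI)
  have un: "u \<otimes>\<^sub>k 1\<^sub>m n \<in> carrier_mat n (a * n)" and vn: "v \<otimes>\<^sub>k 1\<^sub>m n \<in> carrier_mat (b * n) n"
    using kron_carrier[OF u, of "1\<^sub>m n" n n] kron_carrier[OF v, of "1\<^sub>m n" n n] by auto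
  then have uX: "(u \<otimes>\<^sub>k 1\<^sub>m n) * X \<in> carrier_mat n (b * n)"
    using X by simp
  show "dim_row (su n (block_odot n X (S \<otimes>\<^sub>k 1\<^sub>m n))) = dim_row ((u \<otimes>\<^sub>k 1\<^sub>m n) * X * (v \<otimes>\<^sub>k 1\<^sub>m n))"
    "dim_col (su n (block_odot n X (S \<otimes>\<^sub>k 1\<^sub>m n))) = dim_col ((u \<otimes>\<^sub>k 1\<^sub>m n) * X * (v \<otimes>\<^sub>k 1\<^sub>m n))"
    using un vn by (auto simp: su_def)
  fix r s
  assume "r < dim_row ((u \<otimes>\<^sub>k 1\<^sub>m n) * X * (v \<otimes>\<^sub>k 1\<^sub>m n))" "s < dim_col ((u \<otimes>\<^sub>k 1\<^sub>m n) * X * (v \<otimes>\<^sub>k 1\<^sub>m n))"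
  then have rs: "r < n" "s < n"
    using un vn by auto
  have "((u \<otimes>\<^sub>k 1\<^sub>m n) * X * (v \<otimes>\<^sub>k 1\<^sub>m n)) $$ (r, s)
      = (\<Sum>j<b. ((u \<otimes>\<^sub>k 1\<^sub>m n) * X) $$ (r, j * n + s) * v $$ (j, 0))"
    using index_mult_kron_one[OF uX v, of r 0 s] rs by simp
  also have "\<dots> = (\<Sum>j<b. (\<Sum>i<a. u $$ (0, i) * X $$ (i * n + r, j * n + s)) * v $$ (j, 0))"
    using index_kron_one_mult[OF X u, of 0 r] rs block_index_less[of _ b s n]
    by (intro sum.cong refl) simp
  also have "\<dots> = (\<Sum>j<b. \<Sum>i<a. X $$ (i * n + r, j * n + s) * S $$ (i, j))"
    unfolding sum_distrib_right by (intro sum.cong refl) (simp add: S mult_ac)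
  also have "\<dots> = (\<Sum>i<a. \<Sum>j<b. X $$ (i * n + r, j * n + s) * S $$ (i, j))"
    by (rule sum.swap)
  finally show "su n (block_odot n X (S \<otimes>\<^sub>k 1\<^sub>m n)) $$ (r, s)
      = ((u \<otimes>\<^sub>k 1\<^sub>m n) * X * (v \<otimes>\<^sub>k 1\<^sub>m n)) $$ (r, s)"
    using rs su_block_odot_kron_one[OF X S(1)] by simp
qed

subsection \<open>Degrees and reversal\<close>

lemma coeff_rev_poly: "coeff (rev_poly d p) k = (if k \<le> d then coeff p (d - k) else 0)"
proof -
  have "coeff (rev_poly d p) k = (\<Sum>i\<le>d. if i = d - k \<and> k \<le> d then coeff p i else 0)"
    unfolding rev_poly_def coeff_sum by (intro sum.cong refl) auto
  also have "\<dots> = (if k \<le> d then coeff p (d - k) else 0)"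
    by (cases "k \<le> d") auto
  finally show ?thesis .
qed

lemma rev_poly_0 [simp]: "rev_poly d 0 = 0"
  by (simp add: rev_poly_def)

lemma rev_poly_minus: "rev_poly d (- p) = - rev_poly d p"
  by (rule poly_eqI) (simp add: coeff_rev_poly)

lemma rev_poly_monom: "k \<le> d \<Longrightarrow> rev_poly d (monom c k) = monom c (d - k)"
  by (rule poly_eqI) (auto simp: coeff_rev_poly)

lemma rev_poly_smult: "rev_poly d (smult c p) = smult c (rev_poly d p)"
  by (rule poly_eqI) (simp add: coeff_rev_poly)

lemma rev_poly_sum: "rev_poly d (\<Sum>i\<in>I. f i) = (\<Sum>i\<in>I. rev_poly d (f i))"
  by (rule poly_eqI) (simp add: coeff_rev_poly coeff_sum)

text \<open>Reversal at grade \<open>d\<close> is reflection shifted by the gap between grade and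
  degree. This gives access to the multiplicativity of \<open>reflect_poly\<close>.\<close>

lemma rev_poly_conv_reflect_poly:
  assumes "degree p \<le> d"
  shows "rev_poly d p = monom 1 (d - degree p) * reflect_poly p"
  using assms
  by (intro poly_eqI) (auto simp: coeff_rev_poly coeff_monom_mult coeff_reflect_poly coeff_eq_0)

text \<open>Over a field degrees add, hence so do the gaps between grade and degree. Zero factors
  are split off because additivity of degrees fails for them.\<close>

lemma rev_poly_mult:
  assumes "degree p \<le> a" "degree q \<le> b"
  shows "rev_poly (a + b) (p * q) = rev_poly a p * rev_poly b q"
proof (cases "p = 0 \<or> q = 0")
  case False
  have "degree (p * q) \<le> a + b"
    using assms degree_mult_le[of p q] by linarith
  then have "rev_poly (a + b) (p * q)
      = monom 1 (a - degree p + (b - degree q)) * (reflect_poly p * reflect_poly q)"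
    using False assms by (simp add: rev_poly_conv_reflect_poly reflect_poly_mult degree_mult_eq)
  also have "\<dots> = rev_poly a p * rev_poly b q"
    using mult_monom[of "1::'a" "a - degree p" 1 "b - degree q"]
    by (simp add: rev_poly_conv_reflect_poly assms mult_ac)
  finally show ?thesis .
qed auto

section \<open>Entrywise degree bounds and reversal of matrices\<close>

text \<open>A bound rather than an exact degree: bounds add under products, as grades do under
  reversal, and they make sense for empty matrices such as the border when
  \<open>t = 1\<close>.\<close>

definition mat_degree_le :: "'a::field poly mat \<Rightarrow> nat \<Rightarrow> bool" where
  "mat_degree_le X d \<longleftrightarrow> (\<forall>i<dim_row X. \<forall>j<dim_col X. degree (X $$ (i, j)) \<le> d)"

lemma rev_mat_carrier [simp]: "rev_mat d X \<in> carrier_mat m n \<longleftrightarrow> X \<in> carrier_mat m n"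
  by (simp add: rev_mat_def)

text \<open>All summands of an entry of the product are reversed at the same grade
  \<open>a + b\<close>, so additivity of \<open>rev_poly\<close> and its product rule suffice.
  Through this rule the identities for the blocks \<open>M12\<close>, \<open>M21\<close> and
  \<open>M22\<close> pass to the reversed pencil.\<close>

lemma rev_mat_mult:
  assumes "X \<in> carrier_mat l m" "Y \<in> carrier_mat m n" "mat_degree_le X a" "mat_degree_le Y b"
  shows "rev_mat (a + b) (X * Y) = rev_mat a X * rev_mat b Y"
  using assms
  by (intro eq_matI)
    (auto simp: rev_mat_def mat_degree_le_def scalar_prod_def rev_poly_sum rev_poly_mult
      intro!: sum.cong)

lemma mat_degree_le_mult:
  assumes "X \<in> carrier_mat l m" "Y \<in> carrier_mat m n" "mat_degree_le X a" "mat_degree_le Y b"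
  shows "mat_degree_le (X * Y) (a + b)"
proof -
  have "degree (X $$ (i, k) * Y $$ (k, j)) \<le> a + b" if "i < l" "j < n" "k < m" for i j k
  proof -
    have "degree (X $$ (i, k)) \<le> a" "degree (Y $$ (k, j)) \<le> b"
      using assms that unfolding mat_degree_le_def by blast+
    then show ?thesis
      using degree_mult_le[of "X $$ (i, k)" "Y $$ (k, j)"] by linarith
  qed
  then show ?thesis
    using assms(1,2) by (auto simp: mat_degree_le_def scalar_prod_def intro!: degree_sum_le)
qed

text \<open>The coefficients of degree 1 and 0, taken entrywise, are the two matrices of the
  pencil.\<close>

lemma is_pencilI:
  fixes L :: "'a::field poly mat"
  assumes "mat_degree_le L 1"
  shows "is_pencil L"
proof -
  let ?c = "\<lambda>k. map_mat (\<lambda>p. coeff p k) L"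
  have "L = pencil_mat (?c 1) (?c 0)"
  proof (rule eq_matI)
    fix i j
    assume "i < dim_row (pencil_mat (?c 1) (?c 0))" "j < dim_col (pencil_mat (?c 1) (?c 0))"
    then have ij: "i < dim_row L" "j < dim_col L"
      by (auto simp: pencil_mat_def const_mat_def)
    then have "degree (L $$ (i, j)) \<le> 1"
      using assms by (auto simp: mat_degree_le_def)
    then have "L $$ (i, j) = monom 1 1 * [:coeff (L $$ (i, j)) 1:] + [:coeff (L $$ (i, j)) 0:]"
      by (intro poly_eqI)
        (auto simp: coeff_monom_mult coeff_pCons coeff_eq_0 split: nat.splits)
    then show "L $$ (i, j) = pencil_mat (?c 1) (?c 0) $$ (i, j)"
      using ij by (simp add: pencil_mat_def const_mat_def)
  qed (auto simp: pencil_mat_def const_mat_def)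
  then show ?thesis
    unfolding is_pencil_def by (intro exI[of _ "?c 1"] exI[of _ "?c 0"]) auto
qed

lemma mat_degree_le_rev_mat: "mat_degree_le (rev_mat d X) d"
  by (auto simp: mat_degree_le_def rev_mat_def coeff_rev_poly intro!: degree_le)

lemma mat_degree_le_pencil_mat:
  assumes "X \<in> carrier_mat m n" "Y \<in> carrier_mat m n"
  shows "mat_degree_le (pencil_mat X Y) 1"
  using assms
  by (auto simp: mat_degree_le_def pencil_mat_def const_mat_def coeff_monom_mult coeff_pCons
      intro!: degree_le split: nat.splits)

lemma mat_degree_le_kron_one:
  assumes "mat_degree_le X d"
  shows "mat_degree_le (X \<otimes>\<^sub>k 1\<^sub>m n) d"
  using assms
  by (cases "n = 0") (auto simp: mat_degree_le_def kron_def less_mult_imp_div_less)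

text \<open>Forward it passes the bound for \<open>\<lambda>B + A\<close> to \<open>M12\<close>,
  \<open>M21\<close> and \<open>M22\<close>; backward it assembles the bound for the bordered
  pencil.\<close>

lemma mat_degree_le_four_block:
  assumes "A \<in> carrier_mat a b" "B \<in> carrier_mat a b'" "C \<in> carrier_mat a' b" "D \<in> carrier_mat a' b'"
  shows "mat_degree_le (four_block_mat A B C D) d \<longleftrightarrow>
    mat_degree_le A d \<and> mat_degree_le B d \<and> mat_degree_le C d \<and> mat_degree_le D d"
proof
  assume F: "mat_degree_le (four_block_mat A B C D) d"
  have F': "degree (four_block_mat A B C D $$ (i, j)) \<le> d" if "i < a + a'" "j < b + b'" for i j
    using F that assms by (auto simp: mat_degree_le_def)
  have "degree (A $$ (i, j)) \<le> d" if "i < a" "j < b" for i j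
    using F'[of i j] that assms by auto
  moreover have "degree (B $$ (i, j)) \<le> d" if "i < a" "j < b'" for i j
    using F'[of i "b + j"] that assms by auto
  moreover have "degree (C $$ (i, j)) \<le> d" if "i < a'" "j < b" for i j
    using F'[of "a + i" j] that assms by auto
  moreover have "degree (D $$ (i, j)) \<le> d" if "i < a'" "j < b'" for i j
    using F'[of "a + i" "b + j"] that assms by auto
  ultimately show "mat_degree_le A d \<and> mat_degree_le B d \<and> mat_degree_le C d \<and> mat_degree_le D d"
    using assms by (auto simp: mat_degree_le_def)
qed (use assms in \<open>auto simp: mat_degree_le_def\<close>)

section \<open>Matrix polynomials, constant matrices and the leading coefficient\<close>

lemma matpoly_carrier [simp]: "matpoly n C d \<in> carrier_mat n n"
  by (simp add: matpoly_def)

lemma dim_matpoly [simp]: "dim_row (matpoly n C d) = n" "dim_col (matpoly n C d) = n"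
  by (auto simp: matpoly_def)

lemma const_mat_carrier [simp]: "const_mat X \<in> carrier_mat m n \<longleftrightarrow> X \<in> carrier_mat m n"
  by (simp add: const_mat_def)

lemma index_const_mat [simp]:
  "i < dim_row X \<Longrightarrow> j < dim_col X \<Longrightarrow> const_mat X $$ (i, j) = [:X $$ (i, j):]"
  "dim_row (const_mat X) = dim_row X" "dim_col (const_mat X) = dim_col X"
  by (auto simp: const_mat_def)

lemma const_mat_mult:
  assumes "X \<in> carrier_mat l m" "Y \<in> carrier_mat m n"
  shows "const_mat (X * Y) = const_mat X * const_mat Y"
proof -
  have pC: "[:\<Sum>i\<in>I. f i:] = (\<Sum>i\<in>I. [:f i:])" for f :: "nat \<Rightarrow> 'a" and I
    by (rule poly_eqI) (auto simp: coeff_sum coeff_pCons split: nat.splits)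
  show ?thesis
    using assms
    by (intro eq_matI) (auto simp: scalar_prod_def pC intro!: sum.cong)
qed

lemma const_mat_one: "const_mat (1\<^sub>m n) = 1\<^sub>m n"
  by (rule eq_matI) (auto simp: one_pCons)

lemma coeff_matpoly:
  assumes "i < n" "j < n"
  shows "coeff (matpoly n C d $$ (i, j)) k = (if k \<le> d then C k $$ (i, j) else 0)"
  using assms by (simp add: matpoly_def coeff_sum)

lemma matpoly_split:
  assumes "d \<ge> 1" "C d \<in> carrier_mat n n"
  shows "matpoly n C d = matpoly n C (d - 1) + monom 1 d \<cdot>\<^sub>m const_mat (C d)"
proof -
  obtain e where "d = Suc e"
    using assms by (cases d) auto
  then show ?thesis
    using assms(2) by (intro eq_matI) (auto simp: matpoly_def smult_monom)
qed

text \<open>Reversal moves the leading coefficient to the constant term. The remaining part is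
  reversed at grade \<open>d - 1\<close> even if its degree is smaller, so that exactly one factor
  \<open>\<lambda>\<close> is left over.\<close>

lemma rev_matpoly_split:
  assumes "d \<ge> 1" "C d \<in> carrier_mat n n"
  shows "rev_mat d (matpoly n C d)
    = const_mat (C d) + monom 1 1 \<cdot>\<^sub>m rev_mat (d - 1) (matpoly n C (d - 1))"
proof (rule eq_matI, goal_cases)
  case (1 i j)
  then have ij: "i < n" "j < n"
    by (auto simp: rev_mat_def matpoly_def)
  have "rev_poly d (matpoly n C d $$ (i, j))
      = [:C d $$ (i, j):] + monom 1 1 * rev_poly (d - 1) (matpoly n C (d - 1) $$ (i, j))"
    using assms(1) ij
    by (intro poly_eqI)
      (auto simp: coeff_rev_poly coeff_matpoly coeff_monom_mult coeff_pCons split: nat.splits)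
  then show ?case
    using ij assms by (simp add: rev_mat_def)
qed (use assms in \<open>auto simp: rev_mat_def\<close>)

lemma invertible_matE:
  assumes "invertible_mat X" "X \<in> carrier_mat n n"
  obtains Y where "Y \<in> carrier_mat n n" "X * Y = 1\<^sub>m n" "Y * X = 1\<^sub>m n"
proof -
  obtain Y where Y: "X * Y = 1\<^sub>m n" "Y * X = 1\<^sub>m (dim_row Y)"
    using assms by (auto simp: invertible_mat_def inverts_mat_def)
  then have "Y \<in> carrier_mat n n"
    using assms(2) by (metis carrier_matD carrier_matI index_mult_mat(2,3) index_one_mat(2,3))
  with Y that show thesis
    by auto
qed

text \<open>An invertible matrix of size at least 1 has a nonzero entry, and at that position the
  degree \<open>d\<close> is attained. So the reversal in \<open>strong_linearization\<close> is
  taken at grade \<open>d\<close>.\<close>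

lemma mat_degree_matpoly:
  fixes C :: "nat \<Rightarrow> 'a::field mat"
  assumes "n \<ge> 1" "C d \<in> carrier_mat n n" "invertible_mat (C d)"
  shows "mat_degree (matpoly n C d) = d"
proof -
  have le: "degree p \<le> d" if "p \<in> elements_mat (matpoly n C d)" for p
    using that
    by (auto simp: elements_mat_def coeff_matpoly matpoly_def coeff_sum intro!: degree_le)
  have "\<exists>i<n. \<exists>j<n. C d $$ (i, j) \<noteq> 0"
  proof (rule ccontr)
    assume "\<not> ?thesis"
    then have "C d = 0\<^sub>m n n"
      using assms(2) by (intro eq_matI) auto
    moreover obtain E where "E \<in> carrier_mat n n" "C d * E = 1\<^sub>m n"
      using invertible_matE[OF assms(3,2)] .
    ultimately have "(0\<^sub>m n n :: 'a mat) = 1\<^sub>m n"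
      by simp
    then have "(0\<^sub>m n n :: 'a mat) $$ (0, 0) = 1\<^sub>m n $$ (0, 0)"
      by simp
    then show False
      using assms(1) by simp
  qed
  then obtain i j where ij: "i < n" "j < n" "C d $$ (i, j) \<noteq> 0"
    by blast
  let ?p = "matpoly n C d $$ (i, j)"
  have p: "?p \<in> elements_mat (matpoly n C d)"
    using ij by (intro elements_matI[of _ n n i j]) auto
  moreover have "degree ?p = d"
    using ij le[OF p] by (intro antisym le_degree) (auto simp: coeff_matpoly)
  ultimately have "d \<in> degree ` elements_mat (matpoly n C d)"
    by force
  then show ?thesis
    unfolding mat_degree_def using le
    by (intro Max_eqI) (auto simp: elements_mat_def)
qed

lemma rev_mat_transpose: "rev_mat d (transpose_mat X) = transpose_mat (rev_mat d X)"
  by (rule eq_matI) (auto simp: rev_mat_def)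

lemma rev_mat_kron_one: "rev_mat d (X \<otimes>\<^sub>k 1\<^sub>m n) = rev_mat d X \<otimes>\<^sub>k 1\<^sub>m n"
  unfolding rev_mat_def by (rule map_kron_one) simp

lemma rev_mat_smult_const: "rev_mat d ([:c:] \<cdot>\<^sub>m X) = [:c:] \<cdot>\<^sub>m rev_mat d X"
  by (rule eq_matI) (auto simp: rev_mat_def rev_poly_smult)

lemma rev_mat_four_block:
  assumes "A \<in> carrier_mat a b" "B \<in> carrier_mat a b'" "C \<in> carrier_mat a' b" "D \<in> carrier_mat a' b'"
  shows "rev_mat d (four_block_mat A B C D)
    = four_block_mat (rev_mat d A) (rev_mat d B) (rev_mat d C) (rev_mat d D)"
  unfolding rev_mat_def by (rule map_four_block_mat[OF assms])

lemma rev_mat_monom_smult_const_mat: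
  assumes "i \<le> d"
  shows "rev_mat d (monom 1 i \<cdot>\<^sub>m const_mat X) = monom 1 (d - i) \<cdot>\<^sub>m const_mat X"
proof (rule eq_matI)
  fix a b
  assume "a < dim_row (monom 1 (d - i) \<cdot>\<^sub>m const_mat X)" "b < dim_col (monom 1 (d - i) \<cdot>\<^sub>m const_mat X)"
  moreover have "monom 1 j * [:c:] = monom c j" for j and c :: 'a
    by (rule poly_eqI) (auto simp: coeff_monom_mult coeff_pCons split: nat.splits)
  ultimately show "rev_mat d (monom 1 i \<cdot>\<^sub>m const_mat X) $$ (a, b) = (monom 1 (d - i) \<cdot>\<^sub>m const_mat X) $$ (a, b)"
    using assms by (simp add: rev_mat_def rev_poly_monom del: mult_pCons_right)
qed (auto simp: rev_mat_def)

lemma mat_degree_le_transpose: "mat_degree_le (transpose_mat X) d \<longleftrightarrow> mat_degree_le X d"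
  by (auto simp: mat_degree_le_def)

subsection \<open>Reduction of the bordered pencil\<close>

text \<open>Padding both transformations by an identity block does not change their
  determinants.\<close>

lemma uequiv_diag:
  assumes "uequiv N N'" "N \<in> carrier_mat r c"
  shows "uequiv (four_block_mat (1\<^sub>m m) (0\<^sub>m m c) (0\<^sub>m r m) N)
    (four_block_mat (1\<^sub>m m) (0\<^sub>m m c) (0\<^sub>m r m) N')"
proof -
  obtain U V where UV: "U \<in> carrier_mat r r" "unimodular U" "V \<in> carrier_mat c c" "unimodular V"
    "U * N * V = N'"
    using assms unfolding uequiv_def by auto
  let ?diag = "\<lambda>k X. four_block_mat (1\<^sub>m m) (0\<^sub>m m k) (0\<^sub>m k m) X"
  have unimod: "unimodular (?diag k X)" if "X \<in> carrier_mat k k" "unimodular X" for k and X :: "'a poly mat"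
    using that det_four_block_mat_lower_left_zero[of "1\<^sub>m m" m "0\<^sub>m m k" k "0\<^sub>m k m" X]
    unfolding unimodular_def by auto
  have "?diag r U * four_block_mat (1\<^sub>m m) (0\<^sub>m m c) (0\<^sub>m r m) N
      = four_block_mat (1\<^sub>m m) (0\<^sub>m m c) (0\<^sub>m r m) (U * N)"
    using UV assms(2) by (subst mult_four_block_mat[of _ m m _ r _ r _ _ m _ c])
      (auto intro!: cong_four_block_mat)
  also have "\<dots> * ?diag c V = four_block_mat (1\<^sub>m m) (0\<^sub>m m c) (0\<^sub>m r m) N'"
    using UV assms(2) by (subst mult_four_block_mat[of _ m m _ c _ r _ _ m _ c])
      (auto intro!: cong_four_block_mat)
  finally show ?thesis
    using UV assms(2) by (intro uequivI_unimodular[OF _ _ unimod[of U r] _ unimod[of V c]]) auto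
qed

text \<open>The bordered reduction with \<open>r\<close> and \<open>q\<close> taken as
  \<open>2 * n\<close> and \<open>k * n\<close>. Since \<open>W1\<close> is
  \<open>diag(1, Lam)\<close>, the compression splits into the products of \<open>M11\<close>,
  \<open>M12\<close>, \<open>M21\<close> and \<open>M22\<close> that the hypotheses of the theorem
  prescribe.\<close>

lemma uequiv_bordered_kron:
  fixes M11 M12 M21 M22 H W2 R Lam :: "'a::field poly mat" and s :: "'a poly"
  assumes M: "M11 \<in> carrier_mat n n" "M12 \<in> carrier_mat n (Suc k * n)"
      "M21 \<in> carrier_mat (Suc k * n) n" "M22 \<in> carrier_mat (Suc k * n) (Suc k * n)"
    and H: "H \<in> carrier_mat k (k + 2)" and Lam: "Lam \<in> carrier_mat (Suc k) 1"
    and W2: "W2 \<in> carrier_mat (k + 2) k" and R: "R \<in> carrier_mat 2 (k + 2)"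
  defines "W1 \<equiv> four_block_mat (1\<^sub>m 1) (0\<^sub>m 1 1) (0\<^sub>m (Suc k) 1) Lam"
  assumes HW: "H * W1 = 0\<^sub>m k 2" "H * W2 = 1\<^sub>m k" and RW: "R * W1 = 1\<^sub>m 2" "R * W2 = 0\<^sub>m 2 k"
    and s: "s * s = 1"
  shows "uequiv (four_block_mat (four_block_mat M11 M12 M21 M22)
      (transpose_mat H \<otimes>\<^sub>k 1\<^sub>m n) (s \<cdot>\<^sub>m (H \<otimes>\<^sub>k 1\<^sub>m n)) (0\<^sub>m (k * n) (k * n)))
    (four_block_mat (1\<^sub>m (k * n + k * n)) (0\<^sub>m (k * n + k * n) (2 * n)) (0\<^sub>m (2 * n) (k * n + k * n))
      (four_block_mat M11 (M12 * (Lam \<otimes>\<^sub>k 1\<^sub>m n)) ((transpose_mat Lam \<otimes>\<^sub>k 1\<^sub>m n) * M21)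
        ((transpose_mat Lam \<otimes>\<^sub>k 1\<^sub>m n) * M22 * (Lam \<otimes>\<^sub>k 1\<^sub>m n))))"
proof -
  let ?k = "\<lambda>X. X \<otimes>\<^sub>k 1\<^sub>m n"
  let ?X = "four_block_mat M11 M12 M21 M22"
  have W1: "W1 \<in> carrier_mat (k + 2) 2"
    using Lam unfolding W1_def by (intro carrier_matI) auto
  have size: "2 * n + k * n = (k + 2) * n" "n + Suc k * n = (k + 2) * n"
    by (auto simp: algebra_simps)
  have kcar: "A \<otimes>\<^sub>k 1\<^sub>m n \<in> carrier_mat (a * n) (b * n)" if "A \<in> carrier_mat a b" for a b and A :: "'a poly mat"
    using that by simp
  have X: "?X \<in> carrier_mat ((k + 2) * n) ((k + 2) * n)"
    using four_block_carrier_mat[OF M(1,4)] unfolding size .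
  have kLam: "?k Lam \<in> carrier_mat (Suc k * n) n"
    using kcar[OF Lam] by simp
  have W1n: "?k W1 = four_block_mat (1\<^sub>m n) (0\<^sub>m n n) (0\<^sub>m (Suc k * n) n) (?k Lam)"
    unfolding W1_def using Lam
    by (subst kron_one_four_block[of _ 1 1 _ 1 _ "Suc k"]) (auto simp: kron_one_one zero_kron_one)
  have tW1n: "transpose_mat (?k W1)
      = four_block_mat (1\<^sub>m n) (0\<^sub>m n (Suc k * n)) (0\<^sub>m n n) (?k (transpose_mat Lam))"
    unfolding W1n using kLam transpose_kron_one[of Lam n]
    by (subst transpose_four_block_mat[of _ n n _ n _ "Suc k * n"]) auto
  have tLam: "?k (transpose_mat Lam) \<in> carrier_mat n (Suc k * n)"
    using kLam transpose_kron_one[of Lam n] by (metis transpose_carrier_mat)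
  have "transpose_mat (?k W1) * ?X
      = four_block_mat M11 M12 (?k (transpose_mat Lam) * M21) (?k (transpose_mat Lam) * M22)"
    unfolding tW1n using tLam M
    by (subst mult_four_block_mat[of _ n n _ "Suc k * n" _ n _ _ n _ "Suc k * n"])
      (auto simp del: mult_Suc intro!: cong_four_block_mat)
  also have "\<dots> * ?k W1 = four_block_mat M11 (M12 * ?k Lam) (?k (transpose_mat Lam) * M21)
        (?k (transpose_mat Lam) * M22 * ?k Lam)"
    unfolding W1n using tLam kLam M
    by (subst mult_four_block_mat[of _ n n _ "Suc k * n" _ n _ _ n _ n])
      (auto simp del: mult_Suc intro!: cong_four_block_mat)
  finally have compressed: "transpose_mat (?k W1) * ?X * ?k W1
      = four_block_mat M11 (M12 * ?k Lam) (?k (transpose_mat Lam) * M21)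
        (?k (transpose_mat Lam) * M22 * ?k Lam)" .
  have "uequiv (four_block_mat ?X (transpose_mat (?k H)) (s \<cdot>\<^sub>m ?k H) (0\<^sub>m (k * n) (k * n)))
     (four_block_mat (1\<^sub>m (k * n + k * n)) (0\<^sub>m (k * n + k * n) (2 * n)) (0\<^sub>m (2 * n) (k * n + k * n))
       (transpose_mat (?k W1) * ?X * ?k W1))"
  proof (rule uequiv_bordered[of _ _ _ _ _ "?k W2" "?k R"], unfold size)
    show "?k H * ?k W1 = 0\<^sub>m (k * n) (2 * n)" "?k H * ?k W2 = 1\<^sub>m (k * n)"
      "?k R * ?k W1 = 1\<^sub>m (2 * n)" "?k R * ?k W2 = 0\<^sub>m (2 * n) (k * n)"
      unfolding kron_one_mult[OF H W1] kron_one_mult[OF H W2] kron_one_mult[OF R W1]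
        kron_one_mult[OF R W2] HW RW zero_kron_one kron_one_one by auto
  qed (fact X kcar[OF H] kcar[OF W1] kcar[OF W2] kcar[OF R] s)+
  then show ?thesis
    unfolding compressed unfolding transpose_kron_one .
qed

section \<open>Reducing the 2 by 2 block cores\<close>

text \<open>Applied with \<open>D = P_d\<close> and \<open>b = \<lambda>^t\<close>: the pivot
  \<open>- D\<close> is invertible, and its Schur complement is \<open>P\<close>.\<close>

lemma uequiv_two_by_two_leading:
  fixes D E Q :: "'a::field poly mat"
  assumes "D \<in> carrier_mat n n" "E \<in> carrier_mat n n" "D * E = 1\<^sub>m n" "E * D = 1\<^sub>m n"
    and "Q \<in> carrier_mat n n"
  shows "uequiv (four_block_mat (- D) (b \<cdot>\<^sub>m D) (b \<cdot>\<^sub>m D) Q)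
    (four_block_mat (1\<^sub>m n) (0\<^sub>m n n) (0\<^sub>m n n) (Q + (b * b) \<cdot>\<^sub>m D))"
proof -
  have "- D * - E = 1\<^sub>m n" "- E * - D = 1\<^sub>m n"
    using assms by auto
  then have "uequiv (four_block_mat (- D) (b \<cdot>\<^sub>m D) (b \<cdot>\<^sub>m D) Q)
    (four_block_mat (1\<^sub>m n) (0\<^sub>m n n) (0\<^sub>m n n) (Q - (b \<cdot>\<^sub>m D) * (- E) * (b \<cdot>\<^sub>m D)))"
    using assms by (intro uequiv_schur) auto
  also have "(b \<cdot>\<^sub>m D) * (- E) * (b \<cdot>\<^sub>m D) = - ((b * b) \<cdot>\<^sub>m D)"
  proof -
    have "(b \<cdot>\<^sub>m D) * (- E) = - (b \<cdot>\<^sub>m 1\<^sub>m n)"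
      using assms mult_smult_assoc_mat[of D n n E n b] by simp
    moreover have "(b \<cdot>\<^sub>m 1\<^sub>m n) * (b \<cdot>\<^sub>m D) = (b * b) \<cdot>\<^sub>m D"
      using assms mult_smult_assoc_mat[of "1\<^sub>m n" n n "b \<cdot>\<^sub>m D" n b]
      by (auto simp: mult.assoc intro!: eq_matI)
    ultimately show ?thesis
      using assms by simp
  qed
  also have "Q - - ((b * b) \<cdot>\<^sub>m D) = Q + (b * b) \<cdot>\<^sub>m D"
    using assms by (intro eq_matI) auto
  finally show ?thesis .
qed

text \<open>Applied with \<open>b = \<lambda>\<close>, where the corner has no polynomial inverse.
  Exchanging the block columns brings the off-diagonal \<open>D\<close> into pivot position, and its
  Schur complement is the reversal of \<open>P\<close>.\<close>

lemma uequiv_two_by_two_reversed: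
  fixes D E Q :: "'a::field poly mat"
  assumes "D \<in> carrier_mat n n" "E \<in> carrier_mat n n" "D * E = 1\<^sub>m n" "E * D = 1\<^sub>m n"
    and "Q \<in> carrier_mat n n"
  shows "uequiv (four_block_mat (- (b \<cdot>\<^sub>m D)) D D Q)
    (four_block_mat (1\<^sub>m n) (0\<^sub>m n n) (0\<^sub>m n n) (D + b \<cdot>\<^sub>m Q))"
proof -
  have "uequiv (four_block_mat (- (b \<cdot>\<^sub>m D)) D D Q) (four_block_mat D (- (b \<cdot>\<^sub>m D)) Q D)"
    using assms by (intro uequiv_swap_cols) auto
  also have "uequiv \<dots>
    (four_block_mat (1\<^sub>m n) (0\<^sub>m n n) (0\<^sub>m n n) (D - Q * E * - (b \<cdot>\<^sub>m D)))"
    using assms by (intro uequiv_schur) auto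
  also have "Q * E * - (b \<cdot>\<^sub>m D) = - (b \<cdot>\<^sub>m Q)"
    using assms mult_smult_distrib[of "Q * E" n n D n b] by simp
  also have "D - - (b \<cdot>\<^sub>m Q) = D + b \<cdot>\<^sub>m Q"
    using assms by (intro eq_matI) auto
  finally show ?thesis .
qed

section \<open>Completing the border to a unimodular matrix\<close>

lemma index_select_rows_mult:
  fixes X :: "'a::semiring_1 mat"
  assumes "X \<in> carrier_mat m c" "i < r" "j < c" "f i < m"
  shows "(mat r m (\<lambda>(i, j). if j = f i then 1 else 0) * X) $$ (i, j) = X $$ (f i, j)"
proof -
  have "(mat r m (\<lambda>(i, j). if j = f i then 1 else 0) * X) $$ (i, j)
      = (\<Sum>k<m. (if k = f i then 1 else 0) * X $$ (k, j))"
    using assms by (simp add: scalar_prod_def atLeast0LessThan)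
  also have "\<dots> = (\<Sum>k<m. if k = f i then X $$ (k, j) else 0)"
    by (intro sum.cong) auto
  finally show ?thesis
    using assms by simp
qed

text \<open>Taking \<open>a = -1\<close>, \<open>b = \<lambda>\<close> gives \<open>Lhat\<close>,
  and \<open>a = -\<lambda>\<close>, \<open>b = 1\<close> its reversal. Equations with these
  matrices become two-term recursions along a column.\<close>

lemma index_band_mult:
  fixes X :: "'a::semiring_1 mat"
  assumes "X \<in> carrier_mat (k + 2) c" "i < k" "j < c"
  shows "(mat k (k + 2) (\<lambda>(i, j). if j = i + 1 then a else if j = i + 2 then b else 0) * X) $$ (i, j)
    = a * X $$ (i + 1, j) + b * X $$ (i + 2, j)"
proof -
  have "(mat k (k + 2) (\<lambda>(i, j). if j = i + 1 then a else if j = i + 2 then b else 0) * X) $$ (i, j)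
      = (\<Sum>l<k + 2. (if l = i + 1 then a * X $$ (l, j) else 0) + (if l = i + 2 then b * X $$ (l, j) else 0))"
    using assms by (auto simp: scalar_prod_def atLeast0LessThan intro!: sum.cong)
  then show ?thesis
    using assms by (simp add: sum.distrib)
qed

lemma Lhat_conv_band:
  "Lhat (Suc k) = mat k (k + 2) (\<lambda>(i, j). if j = i + 1 then - 1 else if j = i + 2 then monom 1 1 else 0)"
  by (simp add: Lhat_def)

lemma rev_Lhat_conv_band:
  "rev_mat 1 (Lhat (Suc k))
    = mat k (k + 2) (\<lambda>(i, j). if j = i + 1 then - monom 1 1 else if j = i + 2 then 1 else 0)"
  using rev_poly_monom[of 0 1 1] rev_poly_monom[of 1 1 1]
  by (intro eq_matI) (auto simp: Lhat_def rev_mat_def rev_poly_minus)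

lemma Lambda_col_carrier [simp]: "Lambda_col k \<in> carrier_mat (Suc k) 1"
  by (simp add: Lambda_col_def)

lemma index_rev_Lambda_col: "i \<le> k \<Longrightarrow> rev_mat k (Lambda_col k) $$ (i, 0) = monom 1 i"
  by (simp add: rev_mat_def Lambda_col_def rev_poly_monom)

text \<open>\<open>diag(1, Lam)\<close> followed by \<open>W2\<close> is a unimodular matrix whose inverse is \<open>R\<close> stacked on \<open>H\<close>.\<close>

definition lin_completion :: "nat \<Rightarrow> 'a::field poly mat \<Rightarrow> 'a poly mat \<Rightarrow> bool" where
  "lin_completion k H Lam \<longleftrightarrow> (\<exists>W2 R. W2 \<in> carrier_mat (k + 2) k \<and> R \<in> carrier_mat 2 (k + 2)
     \<and> H * four_block_mat (1\<^sub>m 1) (0\<^sub>m 1 1) (0\<^sub>m (Suc k) 1) Lam = 0\<^sub>m k 2 \<and> H * W2 = 1\<^sub>m k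
     \<and> R * four_block_mat (1\<^sub>m 1) (0\<^sub>m 1 1) (0\<^sub>m (Suc k) 1) Lam = 1\<^sub>m 2 \<and> R * W2 = 0\<^sub>m 2 k)"

lemma lin_completion_Lhat:
  "lin_completion k (Lhat (Suc k)) (Lambda_col k :: 'a::field poly mat)"
proof -
  define W1 where "W1 = four_block_mat (1\<^sub>m 1) (0\<^sub>m 1 1) (0\<^sub>m (Suc k) 1) (Lambda_col k :: 'a poly mat)"
  \<comment> \<open>Column \<open>j\<close> solves
    \<open>- x_(i+1) + \<lambda> x_(i+2) = \<delta>_(ij)\<close> by back substitution from
    \<open>x_(k+1) = 0\<close>: the entry at \<open>j + 1\<close> is \<open>-1\<close>, and each
    step upward multiplies by \<open>\<lambda>\<close>. Entry 0 is free and set to 0.\<close>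
  define W2 :: "'a poly mat"
    where "W2 = mat (k + 2) k (\<lambda>(i, j). if 1 \<le> i \<and> i \<le> j + 1 then - monom 1 (j + 1 - i) else 0)"
  \<comment> \<open>On rows \<open>0\<close> and \<open>k + 1\<close>, \<open>W2\<close> vanishes
    and \<open>W1\<close> is the identity, because the last entry of \<open>Lambda_col k\<close> is
    1.\<close>
  define R :: "'a poly mat"
    where "R = mat 2 (k + 2) (\<lambda>(i, j). if j = (if i = 0 then 0 else k + 1) then 1 else 0)"
  have W1: "W1 \<in> carrier_mat (k + 2) 2"
    unfolding W1_def by (intro carrier_matI) (auto simp: Lambda_col_def)
  have W1_index: "W1 $$ (i, j) = (if i = 0 then if j = 0 then 1 else 0
      else if j = 0 then 0 else monom 1 (k + 1 - i))" if "i < k + 2" "j < 2" for i j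
    using that unfolding W1_def by (auto simp: Lambda_col_def)
  have W2: "W2 \<in> carrier_mat (k + 2) k"
    by (simp add: W2_def)
  have R: "R \<in> carrier_mat 2 (k + 2)"
    by (simp add: R_def)
  have "Lhat (Suc k) * W1 = 0\<^sub>m k 2"
  proof (rule eq_matI)
    fix i j
    assume "i < dim_row (0\<^sub>m k 2 :: 'a poly mat)" "j < dim_col (0\<^sub>m k 2 :: 'a poly mat)"
    then have "i < k" "j < 2" by auto
    then show "(Lhat (Suc k) * W1) $$ (i, j) = 0\<^sub>m k 2 $$ (i, j)"
      unfolding Lhat_conv_band index_band_mult[OF W1 \<open>i < k\<close> \<open>j < 2\<close>]
      by (simp add: W1_index mult_monom Suc_diff_Suc)
  qed (use W1 in \<open>auto simp: Lhat_def\<close>)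
  moreover have "Lhat (Suc k) * W2 = 1\<^sub>m k"
  proof (rule eq_matI)
    fix i j
    assume "i < dim_row (1\<^sub>m k :: 'a poly mat)" "j < dim_col (1\<^sub>m k :: 'a poly mat)"
    then have "i < k" "j < k" by auto
    then show "(Lhat (Suc k) * W2) $$ (i, j) = 1\<^sub>m k $$ (i, j)"
      unfolding Lhat_conv_band index_band_mult[OF W2 \<open>i < k\<close> \<open>j < k\<close>]
      by (auto simp: W2_def mult_monom Suc_diff_Suc)
  qed (use W2 in \<open>auto simp: Lhat_def\<close>)
  moreover have "R * W1 = 1\<^sub>m 2"
  proof (rule eq_matI)
    fix i j
    assume "i < dim_row (1\<^sub>m 2 :: 'a poly mat)" "j < dim_col (1\<^sub>m 2 :: 'a poly mat)"
    then have "i < 2" "j < 2" by auto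
    then show "(R * W1) $$ (i, j) = 1\<^sub>m 2 $$ (i, j)"
      unfolding R_def by (subst index_select_rows_mult[OF W1]) (auto simp: W1_index)
  qed (use W1 in \<open>auto simp: R_def\<close>)
  moreover have "R * W2 = 0\<^sub>m 2 k"
  proof (rule eq_matI)
    fix i j
    assume "i < dim_row (0\<^sub>m 2 k :: 'a poly mat)" "j < dim_col (0\<^sub>m 2 k :: 'a poly mat)"
    then have "i < 2" "j < k" by auto
    then show "(R * W2) $$ (i, j) = 0\<^sub>m 2 k $$ (i, j)"
      unfolding R_def by (subst index_select_rows_mult[OF W2]) (auto simp: W2_def)
  qed (use W2 in \<open>auto simp: R_def\<close>)
  ultimately show ?thesis
    unfolding lin_completion_def W1_def[symmetric] using W2 R by blast
qed

text \<open>Reversal moves the entry 1 of the column to its top, so the recursion runs downward and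
  different rows are selected.\<close>

lemma lin_completion_rev_Lhat:
  "lin_completion k (rev_mat 1 (Lhat (Suc k))) (rev_mat k (Lambda_col k) :: 'a::field poly mat)"
proof -
  define W1 where "W1 = four_block_mat (1\<^sub>m 1) (0\<^sub>m 1 1) (0\<^sub>m (Suc k) 1) (rev_mat k (Lambda_col k) :: 'a poly mat)"
  \<comment> \<open>Forward substitution in
    \<open>- \<lambda> x_(i+1) + x_(i+2) = \<delta>_(ij)\<close> from \<open>x_1 = 0\<close>: a 1 at
    \<open>j + 2\<close>, then rising powers of \<open>\<lambda>\<close>. Rows 0 and 1 of
    \<open>W2\<close> vanish and there \<open>W1\<close> is the identity, so \<open>R\<close>
    selects them.\<close>
  define W2 :: "'a poly mat"
    where "W2 = mat (k + 2) k (\<lambda>(i, j). if j + 2 \<le> i then monom 1 (i - (j + 2)) else 0)"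
  define R :: "'a poly mat"
    where "R = mat 2 (k + 2) (\<lambda>(i, j). if j = i then 1 else 0)"
  have W1: "W1 \<in> carrier_mat (k + 2) 2"
    unfolding W1_def by (intro carrier_matI) (auto simp: Lambda_col_def rev_mat_def)
  have dims: "dim_row (rev_mat k (Lambda_col k)) = Suc k" "dim_col (rev_mat k (Lambda_col k)) = 1"
    by (auto simp: rev_mat_def Lambda_col_def)
  have W1_index: "W1 $$ (i, j) = (if i = 0 then if j = 0 then 1 else 0
      else if j = 0 then 0 else monom 1 (i - 1))" if "i < k + 2" "j < 2" for i j
    using that unfolding W1_def by (auto simp: dims index_rev_Lambda_col less_2_cases_iff)
  have W2: "W2 \<in> carrier_mat (k + 2) k"
    by (simp add: W2_def)
  have R: "R \<in> carrier_mat 2 (k + 2)"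
    by (simp add: R_def)
  have H: "rev_mat 1 (Lhat (Suc k)) \<in> carrier_mat k (k + 2)"
    by (simp add: Lhat_def)
  have "rev_mat 1 (Lhat (Suc k)) * W1 = 0\<^sub>m k 2"
  proof (rule eq_matI)
    fix i j
    assume "i < dim_row (0\<^sub>m k 2 :: 'a poly mat)" "j < dim_col (0\<^sub>m k 2 :: 'a poly mat)"
    then have "i < k" "j < 2" by auto
    then show "(rev_mat 1 (Lhat (Suc k)) * W1) $$ (i, j) = 0\<^sub>m k 2 $$ (i, j)"
      unfolding rev_Lhat_conv_band index_band_mult[OF W1 \<open>i < k\<close> \<open>j < 2\<close>]
      by (simp add: W1_index mult_monom)
  qed (use carrier_matD[OF W1] carrier_matD[OF H] in simp_all)
  moreover have "rev_mat 1 (Lhat (Suc k)) * W2 = 1\<^sub>m k"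
  proof (rule eq_matI)
    fix i j
    assume "i < dim_row (1\<^sub>m k :: 'a poly mat)" "j < dim_col (1\<^sub>m k :: 'a poly mat)"
    then have "i < k" "j < k" by auto
    then show "(rev_mat 1 (Lhat (Suc k)) * W2) $$ (i, j) = 1\<^sub>m k $$ (i, j)"
      unfolding rev_Lhat_conv_band index_band_mult[OF W2 \<open>i < k\<close> \<open>j < k\<close>]
      by (auto simp: W2_def mult_monom Suc_diff_Suc)
  qed (use carrier_matD[OF W2] carrier_matD[OF H] in simp_all)
  moreover have "R * W1 = 1\<^sub>m 2"
  proof (rule eq_matI)
    fix i j
    assume "i < dim_row (1\<^sub>m 2 :: 'a poly mat)" "j < dim_col (1\<^sub>m 2 :: 'a poly mat)"
    then have "i < 2" "j < 2" by auto
    then show "(R * W1) $$ (i, j) = 1\<^sub>m 2 $$ (i, j)"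
      unfolding R_def by (subst index_select_rows_mult[OF W1]) (auto simp: W1_index less_2_cases_iff)
  qed (use W1 in \<open>auto simp: R_def\<close>)
  moreover have "R * W2 = 0\<^sub>m 2 k"
  proof (rule eq_matI)
    fix i j
    assume "i < dim_row (0\<^sub>m 2 k :: 'a poly mat)" "j < dim_col (0\<^sub>m 2 k :: 'a poly mat)"
    then have "i < 2" "j < k" by auto
    then show "(R * W2) $$ (i, j) = 0\<^sub>m 2 k $$ (i, j)"
      unfolding R_def by (subst index_select_rows_mult[OF W2]) (auto simp: W2_def)
  qed (use W2 in \<open>auto simp: R_def\<close>)
  ultimately show ?thesis
    unfolding lin_completion_def W1_def[symmetric] using W2 R by blast
qed

text \<open>Common to the pencil and its reversal. Removing the border depends only on
  \<open>H\<close> and \<open>Lam\<close>; the target polynomial enters through the equivalence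
  \<open>core\<close>.\<close>

lemma linearization_bordered_kron:
  fixes M11 M12 M21 M22 H Lam P :: "'a::field poly mat" and s :: "'a poly"
  assumes M: "M11 \<in> carrier_mat n n" "M12 \<in> carrier_mat n (Suc k * n)"
      "M21 \<in> carrier_mat (Suc k * n) n" "M22 \<in> carrier_mat (Suc k * n) (Suc k * n)"
    and H: "H \<in> carrier_mat k (k + 2)" and Lam: "Lam \<in> carrier_mat (Suc k) 1"
    and compl: "lin_completion k H Lam" and s: "s * s = 1" and P: "P \<in> carrier_mat n n"
    and L: "L = four_block_mat (four_block_mat M11 M12 M21 M22)
      (transpose_mat H \<otimes>\<^sub>k 1\<^sub>m n) (s \<cdot>\<^sub>m (H \<otimes>\<^sub>k 1\<^sub>m n)) (0\<^sub>m (k * n) (k * n))"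
    and pencil: "is_pencil L"
    and core: "uequiv (four_block_mat M11 (M12 * (Lam \<otimes>\<^sub>k 1\<^sub>m n)) ((transpose_mat Lam \<otimes>\<^sub>k 1\<^sub>m n) * M21)
        ((transpose_mat Lam \<otimes>\<^sub>k 1\<^sub>m n) * M22 * (Lam \<otimes>\<^sub>k 1\<^sub>m n)))
      (four_block_mat (1\<^sub>m n) (0\<^sub>m n n) (0\<^sub>m n n) P)"
  shows "linearization L P"
proof (rule linearizationI[OF pencil P])
  let ?q = "k * n + k * n"
  show "L \<in> carrier_mat (?q + n + n) (?q + n + n)"
    unfolding L using M by (intro carrier_matI) auto
  obtain W2 R where WR: "W2 \<in> carrier_mat (k + 2) k" "R \<in> carrier_mat 2 (k + 2)"
    "H * four_block_mat (1\<^sub>m 1) (0\<^sub>m 1 1) (0\<^sub>m (Suc k) 1) Lam = 0\<^sub>m k 2" "H * W2 = 1\<^sub>m k"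
    "R * four_block_mat (1\<^sub>m 1) (0\<^sub>m 1 1) (0\<^sub>m (Suc k) 1) Lam = 1\<^sub>m 2" "R * W2 = 0\<^sub>m 2 k"
    using compl unfolding lin_completion_def by blast
  let ?N = "four_block_mat M11 (M12 * (Lam \<otimes>\<^sub>k 1\<^sub>m n)) ((transpose_mat Lam \<otimes>\<^sub>k 1\<^sub>m n) * M21)
        ((transpose_mat Lam \<otimes>\<^sub>k 1\<^sub>m n) * M22 * (Lam \<otimes>\<^sub>k 1\<^sub>m n))"
  have N: "?N \<in> carrier_mat (2 * n) (2 * n)"
    using M Lam by (intro carrier_matI) (auto simp: kron_def)
  have "uequiv L (four_block_mat (1\<^sub>m ?q) (0\<^sub>m ?q (2 * n)) (0\<^sub>m (2 * n) ?q) ?N)"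
    unfolding L by (rule uequiv_bordered_kron[OF M H Lam WR s])
  also have "uequiv \<dots> (four_block_mat (1\<^sub>m ?q) (0\<^sub>m ?q (2 * n)) (0\<^sub>m (2 * n) ?q)
      (four_block_mat (1\<^sub>m n) (0\<^sub>m n n) (0\<^sub>m n n) P))"
    by (rule uequiv_diag[OF core N])
  \<comment> \<open>Reassociating the block diagonal lets the identity of size \<open>n\<close> from
    the core join the large one.\<close>
  also have "\<dots> = four_block_mat (1\<^sub>m (?q + n)) (0\<^sub>m (?q + n) n) (0\<^sub>m n (?q + n)) P"
    using assoc_four_block_mat[of "1\<^sub>m ?q" "1\<^sub>m n" P] P by (simp add: mult_2)
  finally show "uequiv L (four_block_mat (1\<^sub>m (?q + n)) (0\<^sub>m (?q + n) n) (0\<^sub>m n (?q + n)) P)" .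
qed

subsection \<open>The strong linearization\<close>

text \<open>The weights are outer products: the pair \<open>(u, v)\<close> is
  \<open>(1, \<Lambda>)\<close>, \<open>(\<Lambda>^T, 1)\<close> and
  \<open>(\<Lambda>^T, \<Lambda>)\<close> in turn, the last after rewriting \<open>Gamma_mat\<close>
  by the mixed product rule. This turns condition (b) into condition (a).\<close>

lemma su_block_odot_Lambda_col:
  fixes M12 M21 M22 :: "'a::field poly mat"
  assumes M: "M12 \<in> carrier_mat n (Suc k * n)" "M21 \<in> carrier_mat (Suc k * n) n"
    "M22 \<in> carrier_mat (Suc k * n) (Suc k * n)"
  shows "su n (block_odot n M12 (transpose_mat (Lambda_col k) \<otimes>\<^sub>k 1\<^sub>m n)) = M12 * (Lambda_col k \<otimes>\<^sub>k 1\<^sub>m n)"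
    and "su n (block_odot n M21 (Lambda_col k \<otimes>\<^sub>k 1\<^sub>m n)) = (transpose_mat (Lambda_col k) \<otimes>\<^sub>k 1\<^sub>m n) * M21"
    and "su n (block_odot n M22 (Gamma_mat n k))
      = (transpose_mat (Lambda_col k) \<otimes>\<^sub>k 1\<^sub>m n) * M22 * (Lambda_col k \<otimes>\<^sub>k 1\<^sub>m n)"
proof -
  let ?v = "Lambda_col k :: 'a poly mat"
  have v: "?v \<in> carrier_mat (Suc k) 1" and tv: "transpose_mat ?v \<in> carrier_mat 1 (Suc k)"
    by (simp_all only: transpose_carrier_mat Lambda_col_carrier)
  have one: "1\<^sub>m 1 \<otimes>\<^sub>k 1\<^sub>m n = (1\<^sub>m n :: 'a poly mat)"
    by (simp add: kron_one_one)
  have "su n (block_odot n M12 (transpose_mat ?v \<otimes>\<^sub>k 1\<^sub>m n))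
      = (1\<^sub>m 1 \<otimes>\<^sub>k 1\<^sub>m n) * M12 * (?v \<otimes>\<^sub>k 1\<^sub>m n)"
    using M v tv by (intro su_block_odot_outer_product[of _ 1 _ "Suc k"]) auto
  then show "su n (block_odot n M12 (transpose_mat ?v \<otimes>\<^sub>k 1\<^sub>m n)) = M12 * (?v \<otimes>\<^sub>k 1\<^sub>m n)"
    unfolding one left_mult_one_mat[OF M(1)] .
  have "su n (block_odot n M21 (?v \<otimes>\<^sub>k 1\<^sub>m n))
      = (transpose_mat ?v \<otimes>\<^sub>k 1\<^sub>m n) * M21 * (1\<^sub>m 1 \<otimes>\<^sub>k 1\<^sub>m n)"
    using M v tv by (intro su_block_odot_outer_product[of _ "Suc k" _ 1]) auto
  moreover have tv21: "(transpose_mat ?v \<otimes>\<^sub>k 1\<^sub>m n) * M21 \<in> carrier_mat n n"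
    using M(2) kron_carrier[OF tv, of "1\<^sub>m n" n n] by simp
  ultimately show "su n (block_odot n M21 (?v \<otimes>\<^sub>k 1\<^sub>m n)) = (transpose_mat ?v \<otimes>\<^sub>k 1\<^sub>m n) * M21"
    unfolding one right_mult_one_mat[OF tv21] by blast
  have "Gamma_mat n k = (?v * transpose_mat ?v) \<otimes>\<^sub>k 1\<^sub>m n"
    unfolding Gamma_mat_def by (rule kron_one_mult[OF v tv])
  moreover have "su n (block_odot n M22 ((?v * transpose_mat ?v) \<otimes>\<^sub>k 1\<^sub>m n))
      = (transpose_mat ?v \<otimes>\<^sub>k 1\<^sub>m n) * M22 * (?v \<otimes>\<^sub>k 1\<^sub>m n)"
    using M(3) v tv
    by (intro su_block_odot_outer_product[of _ "Suc k" _ "Suc k"])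
      (auto simp: scalar_prod_def)
  ultimately show "su n (block_odot n M22 (Gamma_mat n k))
      = (transpose_mat ?v \<otimes>\<^sub>k 1\<^sub>m n) * M22 * (?v \<otimes>\<^sub>k 1\<^sub>m n)"
    by simp
qed

theorem corollary5p9:
  fixes C :: "nat \<Rightarrow> 'a::field mat"
    and A B :: "'a mat"
    and M11 M12 M21 M22 P Q L :: "'a poly mat"
    and n d t :: nat
    and \<sigma> :: 'a
  assumes n: "n \<ge> 1"
    and d: "even d" "d \<ge> 2"
    and C: "\<And>k. k \<le> d \<Longrightarrow> C k \<in> carrier_mat n n"
    and lead: "invertible_mat (C d)"
    and P: "P = matpoly n C d"
    and Q: "Q = matpoly n C (d - 1)"
    and t: "t = d div 2"
    and \<sigma>: "\<sigma> = 1 \<or> \<sigma> = - 1"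
    and A: "A \<in> carrier_mat (n + t * n) (n + t * n)"
    and B: "B \<in> carrier_mat (n + t * n) (n + t * n)"
    and M11: "M11 \<in> carrier_mat n n"
    and M12: "M12 \<in> carrier_mat n (t * n)"
    and M21: "M21 \<in> carrier_mat (t * n) n"
    and M22: "M22 \<in> carrier_mat (t * n) (t * n)"
    and M: "pencil_mat B A = four_block_mat M11 M12 M21 M22"
    and L: "L = four_block_mat
              (pencil_mat B A)
              (transpose_mat (Lhat t) \<otimes>\<^sub>k 1\<^sub>m n)
              ([:\<sigma>:] \<cdot>\<^sub>m (Lhat t \<otimes>\<^sub>k 1\<^sub>m n))
              (0\<^sub>m ((t - 1) * n) ((t - 1) * n))"
    and ab:
      "(const_mat (C d) = - M11
        \<and> monom 1 t \<cdot>\<^sub>m const_mat (C d) = M12 * (Lambda_col (t - 1) \<otimes>\<^sub>k 1\<^sub>m n)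
        \<and> monom 1 t \<cdot>\<^sub>m const_mat (C d) = (transpose_mat (Lambda_col (t - 1)) \<otimes>\<^sub>k 1\<^sub>m n) * M21
        \<and> Q = (transpose_mat (Lambda_col (t - 1)) \<otimes>\<^sub>k 1\<^sub>m n) * M22 * (Lambda_col (t - 1) \<otimes>\<^sub>k 1\<^sub>m n))
     \<or> (const_mat (C d) = - M11
        \<and> monom 1 t \<cdot>\<^sub>m const_mat (C d)
            = su n (block_odot n M12 (transpose_mat (Lambda_col (t - 1)) \<otimes>\<^sub>k 1\<^sub>m n))
        \<and> monom 1 t \<cdot>\<^sub>m const_mat (C d)
            = su n (block_odot n M21 (Lambda_col (t - 1) \<otimes>\<^sub>k 1\<^sub>m n))
        \<and> Q = su n (block_odot n M22 (Gamma_mat n (t - 1))))"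
  shows "strong_linearization L P"
proof -
  \<comment> \<open>\<open>t\<close> is positive, so it can be written as \<open>Suc k\<close>,
    which removes the truncated subtraction in \<open>t - 1\<close>.\<close>
  have dt: "d = t + t"
    using d t by auto
  with d have "t \<noteq> 0"
    by auto
  then obtain k where k: "t = Suc k"
    using not0_implies_Suc by blast
  have dk: "d = Suc k + Suc k"
    using dt k by simp
  let ?Lam = "Lambda_col k :: 'a poly mat"
  let ?kr = "\<lambda>X :: 'a poly mat. X \<otimes>\<^sub>k 1\<^sub>m n"
  define D where "D = const_mat (C d)"
  have CD: "C d \<in> carrier_mat n n"
    by (simp add: C)
  obtain E0 where E0: "E0 \<in> carrier_mat n n" "C d * E0 = 1\<^sub>m n" "E0 * C d = 1\<^sub>m n"
    using invertible_matE[OF lead CD] .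
  define E where "E = const_mat E0"
  have DE: "D \<in> carrier_mat n n" "E \<in> carrier_mat n n" "D * E = 1\<^sub>m n" "E * D = 1\<^sub>m n"
    unfolding D_def E_def const_mat_mult[OF CD E0(1), symmetric]
      const_mat_mult[OF E0(1) CD, symmetric] E0(2,3)
    using CD E0(1) by (auto simp: const_mat_one)
  note Mk = M11 M12[unfolded k] M21[unfolded k] M22[unfolded k]
  \<comment> \<open>Both alternatives are brought to form (a).\<close>
  have "D = - M11 \<and> monom 1 t \<cdot>\<^sub>m D = M12 * ?kr ?Lam \<and> monom 1 t \<cdot>\<^sub>m D = ?kr (transpose_mat ?Lam) * M21
      \<and> Q = ?kr (transpose_mat ?Lam) * M22 * ?kr ?Lam"
    using ab su_block_odot_Lambda_col[OF Mk(2-4)] by (auto simp: k D_def)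
  then have D_eq: "D = - M11" and M12_eq: "M12 * ?kr ?Lam = monom 1 t \<cdot>\<^sub>m D"
    and M21_eq: "?kr (transpose_mat ?Lam) * M21 = monom 1 t \<cdot>\<^sub>m D"
    and M22_eq: "?kr (transpose_mat ?Lam) * M22 * ?kr ?Lam = Q"
    by auto
  have M11_eq: "M11 = - D"
    unfolding D_eq using M11 by (intro eq_matI) auto
  have ss: "[:\<sigma>:] * [:\<sigma>:] = 1"
    using \<sigma> by auto
  have H: "(Lhat (Suc k) :: 'a poly mat) \<in> carrier_mat k (k + 2)"
    by (simp add: Lhat_def)
  then have tH: "transpose_mat (Lhat (Suc k) :: 'a poly mat) \<in> carrier_mat (k + 2) k"
    by (simp only: transpose_carrier_mat)
  have kH: "?kr (Lhat (Suc k)) \<in> carrier_mat (k * n) ((k + 2) * n)"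
    "?kr (transpose_mat (Lhat (Suc k))) \<in> carrier_mat ((k + 2) * n) (k * n)"
    using kron_carrier[OF H, of "1\<^sub>m n" n n]
      kron_carrier[OF tH, of "1\<^sub>m n" n n] by auto
  have size: "n + Suc k * n = (k + 2) * n"
    by simp
  let ?M = "four_block_mat M11 M12 M21 M22"
  have Mcar: "?M \<in> carrier_mat ((k + 2) * n) ((k + 2) * n)"
    using four_block_carrier_mat[OF Mk(1,4)] unfolding size .
  have L': "L = four_block_mat ?M (transpose_mat (Lhat (Suc k)) \<otimes>\<^sub>k 1\<^sub>m n)
      ([:\<sigma>:] \<cdot>\<^sub>m ?kr (Lhat (Suc k))) (0\<^sub>m (k * n) (k * n))"
    unfolding L M k by simp
  have Mdeg: "mat_degree_le ?M 1"
    unfolding M[symmetric] by (rule mat_degree_le_pencil_mat[OF B A])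
  \<comment> \<open>The blocks inherit degree at most 1 from the pencil; this supplies their grade
    in the reversals below.\<close>
  then have deg: "mat_degree_le M12 1" "mat_degree_le M21 1" "mat_degree_le M22 1"
    using mat_degree_le_four_block[OF M11 M12 M21 M22] by auto
  have Hdeg: "mat_degree_le (Lhat (Suc k) :: 'a poly mat) 1"
    by (auto simp: mat_degree_le_def Lhat_def degree_monom_le)
  have kLam: "?kr ?Lam \<in> carrier_mat (Suc k * n) n"
    using kron_carrier[OF Lambda_col_carrier, of "1\<^sub>m n" n n k] by simp
  have tLam: "?kr (transpose_mat ?Lam) \<in> carrier_mat n (Suc k * n)"
    using kLam transpose_kron_one[of ?Lam n] by (metis transpose_carrier_mat)
  have Ldeg: "mat_degree_le ?Lam k"
    by (auto simp: mat_degree_le_def Lambda_col_def degree_monom_eq)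
  then have kLdeg: "mat_degree_le (?kr ?Lam) k" "mat_degree_le (?kr (transpose_mat ?Lam)) k"
    by (auto intro: mat_degree_le_kron_one simp: mat_degree_le_transpose)
  have "mat_degree_le ([:\<sigma>:] \<cdot>\<^sub>m ?kr (Lhat (Suc k))) 1"
    using mat_degree_le_kron_one[OF Hdeg, of n]
    by (auto simp: mat_degree_le_def intro: order_trans[OF degree_smult_le])
  moreover have "mat_degree_le (?kr (transpose_mat (Lhat (Suc k)))) 1"
    using Hdeg by (intro mat_degree_le_kron_one) (simp add: mat_degree_le_transpose)
  moreover have "mat_degree_le (0\<^sub>m (k * n) (k * n) :: 'a poly mat) 1"
    by (simp add: mat_degree_le_def)
  ultimately have Ldeg: "mat_degree_le L 1"
    unfolding L' using Mdeg Mcar kH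
    by (subst mat_degree_le_four_block[of _ "(k + 2) * n" "(k + 2) * n" _ "k * n" _ "k * n"]) auto
  have Qcar: "Q \<in> carrier_mat n n"
    by (simp add: Q)
  have "linearization L P"
  proof (rule linearization_bordered_kron[OF Mk H Lambda_col_carrier lin_completion_Lhat ss _ L'])
    \<comment> \<open>As \<open>d = 2t\<close>, the square of \<open>\<lambda>^t\<close> from the
      Schur complement restores the leading term.\<close>
    have "P = Q + (monom 1 t * monom 1 t) \<cdot>\<^sub>m D"
      unfolding P Q D_def using matpoly_split[of d C n] CD d by (simp add: mult_monom dk k)
    then show "uequiv (four_block_mat M11 (M12 * ?kr ?Lam) (?kr (transpose_mat ?Lam) * M21)
          (?kr (transpose_mat ?Lam) * M22 * ?kr ?Lam))
        (four_block_mat (1\<^sub>m n) (0\<^sub>m n n) (0\<^sub>m n n) P)"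
      unfolding M12_eq M21_eq M22_eq M11_eq
      using uequiv_two_by_two_leading[OF DE Qcar, of "monom 1 t"] by simp
  qed (auto simp: P intro: is_pencilI[OF Ldeg])
  moreover have "linearization (rev_mat 1 L) (rev_mat (mat_degree P) P)"
  proof -
    have P_deg: "mat_degree P = d"
      unfolding P by (rule mat_degree_matpoly) (use n CD lead in auto)
    let ?r = "rev_mat 1 :: 'a poly mat \<Rightarrow> 'a poly mat"
    let ?rLam = "rev_mat k ?Lam"
    have rL: "?r L = four_block_mat (four_block_mat (?r M11) (?r M12) (?r M21) (?r M22))
      (transpose_mat (?r (Lhat (Suc k))) \<otimes>\<^sub>k 1\<^sub>m n)
      ([:\<sigma>:] \<cdot>\<^sub>m ?kr (?r (Lhat (Suc k)))) (0\<^sub>m (k * n) (k * n))"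
      unfolding L' using Mcar kH
      by (subst rev_mat_four_block[of _ "(k + 2) * n" "(k + 2) * n" _ "k * n" _ "k * n"])
        (auto simp: rev_mat_four_block[OF Mk] rev_mat_kron_one rev_mat_transpose
          rev_mat_smult_const rev_mat_def[of _ "0\<^sub>m _ _"] intro!: cong_four_block_mat eq_matI)
    \<comment> \<open>\<open>M12\<close> has grade 1 and the column \<open>\<Lambda>\<close> grade
      \<open>k\<close>, so their product is reversed at grade \<open>k + 1 = t\<close>, where
      \<open>\<lambda>^t P_d\<close> becomes the constant \<open>P_d\<close>. The same holds for
      \<open>M21\<close>.\<close>
    have rev_D: "rev_mat (Suc k) (monom 1 t \<cdot>\<^sub>m D) = D"
      using rev_mat_monom_smult_const_mat[of t "Suc k" "C d"] unfolding D_def k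
      by (auto intro!: eq_matI)
    have rM11: "?r M11 = - (monom 1 1 \<cdot>\<^sub>m D)"
    proof -
      \<comment> \<open>Written as \<open>\<lambda>^0 P_d\<close>, the constant block becomes
        \<open>\<lambda> P_d\<close> under reversal at grade 1.\<close>
      have "D = monom 1 0 \<cdot>\<^sub>m D"
        by (intro eq_matI) auto
      then have "?r D = monom 1 1 \<cdot>\<^sub>m D"
        using rev_mat_monom_smult_const_mat[of 0 1 "C d"] unfolding D_def by simp
      moreover have "?r (- D) = - ?r D"
        by (intro eq_matI) (auto simp: rev_mat_def rev_poly_minus)
      ultimately show ?thesis
        unfolding M11_eq by simp
    qed
    have rM12: "?r M12 * ?kr ?rLam = D"
      using rev_mat_mult[OF Mk(2) kLam deg(1) kLdeg(1)] unfolding M12_eq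
      by (simp add: rev_D rev_mat_kron_one)
    have rM21: "?kr (transpose_mat ?rLam) * ?r M21 = D"
      using rev_mat_mult[OF tLam Mk(3) kLdeg(2) deg(2)] unfolding M21_eq
      by (simp add: rev_D rev_mat_kron_one rev_mat_transpose)
    \<comment> \<open>The grades of the three factors add up to \<open>d - 1\<close>, the grade at
      which \<open>Q\<close> occurs in the reversal of \<open>P\<close>.\<close>
    have "rev_mat (k + 1 + k) Q = rev_mat k (?kr (transpose_mat ?Lam)) * ?r M22 * rev_mat k (?kr ?Lam)"
      unfolding M22_eq[symmetric] rev_mat_mult[OF mult_carrier_mat[OF tLam Mk(4)] kLam
          mat_degree_le_mult[OF tLam Mk(4) kLdeg(2) deg(3)] kLdeg(1)]
        rev_mat_mult[OF tLam Mk(4) kLdeg(2) deg(3)] ..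
    then have rM22: "?kr (transpose_mat ?rLam) * ?r M22 * ?kr ?rLam = rev_mat (d - 1) Q"
      by (simp add: dk rev_mat_kron_one rev_mat_transpose)
    have rQ: "rev_mat (d - 1) Q \<in> carrier_mat n n"
      using Qcar by simp
    show ?thesis
      unfolding P_deg
    proof (rule linearization_bordered_kron[OF _ _ _ _ _ _ lin_completion_rev_Lhat ss _ rL])
      have "rev_mat d P = D + monom 1 1 \<cdot>\<^sub>m rev_mat (d - 1) Q"
        unfolding P Q D_def using d CD by (intro rev_matpoly_split) auto
      then show "uequiv (four_block_mat (?r M11) (?r M12 * ?kr ?rLam) (?kr (transpose_mat ?rLam) * ?r M21)
          (?kr (transpose_mat ?rLam) * ?r M22 * ?kr ?rLam))
        (four_block_mat (1\<^sub>m n) (0\<^sub>m n n) (0\<^sub>m n n) (rev_mat d P))"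
        unfolding rM11 rM12 rM21 rM22
        using uequiv_two_by_two_reversed[OF DE rQ, of "monom 1 1"] by simp
    qed (use Mk H Lambda_col_carrier[of k] is_pencilI[OF mat_degree_le_rev_mat[of 1 L]]
        in \<open>auto simp: P\<close>)
  qed
  ultimately show ?thesis
    unfolding strong_linearization_def by simp
qed

end
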